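(* Let $1\leq p\leq 2$. A weighted bilateral shift $T$ acting on $\ell_p(\mathbb{Z})$ is supercyclic if and only if $T^2$ is cyclic. On the other hand, for each real number $p>2$ there exists a non-supercyclic weighted bilateral shift $T$ on $\ell_p(\mathbb{Z})$ such that $T^n$ is cyclic for every $n\in\mathbb{N}$.
   Context: All vector spaces are over $\mathbb{C}$; $\mathbb{Z}_+$ is the set of non-negative integers, $\mathbb{N}$ the set of positive integers. A weighted bilateral shift on $\ell_p(\mathbb{Z})$, $1\leq p<\infty$, is the bounded linear operator $T=T_{w,p}$ defined on the canonical basis $\{e_n\}_{n\in\mathbb{Z}}$ by $Te_n=w_ne_{n-1}$ for $n\in\mathbb{Z}$, where $w=\{w_n\}_{n\in\mathbb{Z}}\in\ell_\infty(\mathbb{Z})$ is a bounded sequence of complex numbers with $w_n\neq 0$ for every $n$. A bounded linear operator $T$ on a Banach space $\mathcal{B}$ is cyclic if there is $x\in\mathcal{B}$ such that the linear span of $\{T^nx:n\in\mathbb{Z}_+\}$ is dense in $\mathcal{B}$, and supercyclic if there is $x\in\mathcal{B}$ such that $\{\lambda T^nx:\lambda\in\mathbb{C},\ n\in\mathbb{Z}_+\}$ is dense in $\mathcal{B}$. *)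

theory Defs
  imports "HOL-Analysis.Analysis" "HOL-Library.Function_Algebras"
begin

text \<open>
  The exponent \<open>p\<close> ranges over real numbers, so the sequence spaces are carrier sets inside the
  complex vector space of all functions \<^typ>\<open>int \<Rightarrow> complex\<close> (pointwise addition and zero from
  \<open>Function_Algebras\<close>, scalar multiplication \<open>cscale\<close>), and operators are functions on this ambient
  type of which only the restriction to the carrier matters.
\<close>

definition cscale :: "complex \<Rightarrow> (int \<Rightarrow> complex) \<Rightarrow> int \<Rightarrow> complex" where
  "cscale c x = (\<lambda>n. c * x n)"

interpretation cfun: vector_space cscale
  by unfold_locales (auto simp: cscale_def fun_eq_iff algebra_simps)

definition lp :: "real \<Rightarrow> (int \<Rightarrow> complex) set" where
  "lp p = {x. (\<lambda>n. norm (x n) powr p) summable_on UNIV}"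

definition lp_norm :: "real \<Rightarrow> (int \<Rightarrow> complex) \<Rightarrow> real" where
  "lp_norm p x = (\<Sum>\<^sub>\<infinity>n. norm (x n) powr p) powr (1 / p)"

definition lp_dense :: "real \<Rightarrow> (int \<Rightarrow> complex) set \<Rightarrow> bool" where
  "lp_dense p S \<longleftrightarrow> S \<subseteq> lp p \<and> (\<forall>y\<in>lp p. \<forall>\<epsilon>>0. \<exists>s\<in>S. lp_norm p (y - s) < \<epsilon>)"

definition lp_bounded_linear ::
  "real \<Rightarrow> ((int \<Rightarrow> complex) \<Rightarrow> int \<Rightarrow> complex) \<Rightarrow> bool" where
  "lp_bounded_linear p T \<longleftrightarrow>
     (\<forall>x\<in>lp p. T x \<in> lp p) \<and>
     (\<forall>x\<in>lp p. \<forall>y\<in>lp p. T (x + y) = T x + T y) \<and>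
     (\<forall>c. \<forall>x\<in>lp p. T (cscale c x) = cscale c (T x)) \<and>
     (\<exists>C. \<forall>x\<in>lp p. lp_norm p (T x) \<le> C * lp_norm p x)"

definition basis_vec :: "int \<Rightarrow> int \<Rightarrow> complex" where
  "basis_vec n = (\<lambda>k. if k = n then 1 else 0)"

definition weighted_bilateral_shift ::
  "real \<Rightarrow> (int \<Rightarrow> complex) \<Rightarrow> ((int \<Rightarrow> complex) \<Rightarrow> int \<Rightarrow> complex) \<Rightarrow> bool" where
  "weighted_bilateral_shift p w T \<longleftrightarrow>
     bounded (range w) \<and> (\<forall>n. w n \<noteq> 0) \<and> lp_bounded_linear p T \<and>
     (\<forall>n. T (basis_vec n) = cscale (w n) (basis_vec (n - 1)))"

definition cyclic :: "real \<Rightarrow> ((int \<Rightarrow> complex) \<Rightarrow> int \<Rightarrow> complex) \<Rightarrow> bool" where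
  "cyclic p T \<longleftrightarrow> (\<exists>x\<in>lp p. lp_dense p (cfun.span {(T ^^ n) x |n. True}))"

definition supercyclic :: "real \<Rightarrow> ((int \<Rightarrow> complex) \<Rightarrow> int \<Rightarrow> complex) \<Rightarrow> bool" where
  "supercyclic p T \<longleftrightarrow> (\<exists>x\<in>lp p. lp_dense p {cscale c ((T ^^ n) x) |c n. True})"

text \<open>The shift with given weights exists and is given by the expected coordinate formula.\<close>

lemma weighted_bilateral_shift_coords:
  assumes p: "1 \<le> p" and w: "bounded (range w)" "\<And>n. w n \<noteq> 0"
  shows "weighted_bilateral_shift p w (\<lambda>x n. w (n + 1) * x (n + 1))"
proof -
  define T where "T = (\<lambda>(x::int \<Rightarrow> complex) n. w (n + 1) * x (n + 1))"
  obtain M where M: "0 < M" "\<And>n. norm (w n) \<le> M"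
    using w(1) by (auto simp: bounded_pos)
  have bij: "bij (\<lambda>n::int. n + 1)"
    by (rule bijI') (auto intro: exI[of _ "_ - 1"])
  have key: "T x \<in> lp p \<and> lp_norm p (T x) \<le> M * lp_norm p x" if x: "x \<in> lp p" for x
  proof -
    let ?f = "\<lambda>n. norm (x n) powr p"
    have sf: "?f summable_on UNIV"
      using x by (simp add: lp_def)
    have sf1: "(\<lambda>n. ?f (n + 1)) summable_on UNIV"
      using sf summable_on_reindex_bij_betw[OF bij, of ?f] by simp
    have inf1: "(\<Sum>\<^sub>\<infinity>n. ?f (n + 1)) = (\<Sum>\<^sub>\<infinity>n. ?f n)"
      by (rule infsum_reindex_bij_betw[OF bij])
    have sM: "(\<lambda>n. M powr p * ?f (n + 1)) summable_on UNIV"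
      by (rule summable_on_cmult_right[OF sf1])
    have le: "norm (T x n) powr p \<le> M powr p * ?f (n + 1)" for n
    proof -
      have "norm (T x n) powr p = norm (w (n + 1)) powr p * ?f (n + 1)"
        by (simp add: T_def norm_mult powr_mult)
      also have "\<dots> \<le> M powr p * ?f (n + 1)"
        using M p by (intro mult_right_mono powr_mono2) auto
      finally show ?thesis .
    qed
    have sT: "(\<lambda>n. norm (T x n) powr p) summable_on UNIV"
      by (rule summable_on_comparison_test[OF sM]) (use le in auto)
    have "(\<Sum>\<^sub>\<infinity>n. norm (T x n) powr p) \<le> (\<Sum>\<^sub>\<infinity>n. M powr p * ?f (n + 1))"
      by (rule infsum_mono[OF sT sM]) (rule le)
    also have "\<dots> = M powr p * (\<Sum>\<^sub>\<infinity>n. ?f n)"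
      by (simp add: infsum_cmult_right' inf1)
    finally have "lp_norm p (T x) \<le> (M powr p * (\<Sum>\<^sub>\<infinity>n. ?f n)) powr (1 / p)"
      unfolding lp_norm_def using p by (intro powr_mono2 infsum_nonneg) auto
    also have "\<dots> = M * lp_norm p x"
      using M p by (simp add: lp_norm_def powr_mult powr_powr infsum_nonneg)
    finally show ?thesis
      using sT by (simp add: lp_def)
  qed
  have "lp_bounded_linear p T"
    unfolding lp_bounded_linear_def
    using key by (auto simp: T_def cscale_def fun_eq_iff algebra_simps)
  moreover have "T (basis_vec n) = cscale (w n) (basis_vec (n - 1))" for n
    by (auto simp: T_def basis_vec_def cscale_def fun_eq_iff)
  ultimately show ?thesis
    using w unfolding weighted_bilateral_shift_def T_def by blast
qed

end

theory Submission
  imports Defs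
begin

text \<open>
  Choose nonzero \<open>c n\<close> with \<open>c (n - 1) = w n * c n\<close>. In the coordinates \<open>x n / c
  n\<close> the weighted shift is the translation by one on a weighted sequence space, so the behaviour of
  \<open>T\<close> is governed by the numbers \<open>\<bar>c n\<bar>\<close>. As the weights are bounded,
  \<open>\<bar>c (n - 1)\<bar> \<le> M * \<bar>c n\<bar>\<close>. Everything turns on the smallness condition

    (S)  for each \<open>m\<close> the products \<open>\<bar>c (m - n)\<bar> * \<bar>c (m + n)\<bar>\<close>, \<open>n \<ge> 0\<close>, have infimum 0.

  For each \<open>p \<ge> 1\<close>, (S) is equivalent to supercyclicity. If (S) holds and \<open>z\<close>,
  \<open>y\<close> are finitely supported, then \<open>T ^^ n\<close> takes \<open>z\<close> to a vector of size
  at most of order \<open>\<bar>c (m - n)\<bar>\<close>, while its formal inverse takes \<open>y\<close> to one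
  of size at most of order \<open>\<bar>c (m + n)\<bar>\<close>, for a suitable \<open>m\<close>. Adding a
  suitable multiple of the backward translate of \<open>y\<close> to \<open>z\<close> gives a vector near
  \<open>z\<close> with a multiple of its \<open>n\<close>-th iterate near \<open>y\<close>, and the Baire
  category theorem (\<open>universal_vector_exists\<close>) produces a supercyclic vector
  (\<open>supercyclic_power\<close>). Conversely, if a multiple of an iterate is close to the basis vector at
  \<open>m\<close>, its coordinate at \<open>m\<close> requires a large scalar and its other coordinates require
  a small one (\<open>supercyclic_imp_small_products\<close>). Since one step costs only a factor
  \<open>M\<close>, the exponents in (S) may be taken even, so (S) also makes \<open>T\<^sup>2\<close>
  supercyclic, hence cyclic.

  Let \<open>p \<le> 2\<close> and suppose that (S) fails at \<open>m\<close>. Put \<open>s = 2 * m + 1\<close>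
  and \<open>v n = x n / c n\<close>. For any \<open>x\<close> the functional \<open>\<phi> z = (\<Sum>n. (-1) ^
  n * v (s - n) * (z n / c n))\<close> is bounded: \<open>\<bar>c n\<bar> * \<bar>c (s - n)\<bar>\<close> is
  bounded below, and for \<open>p \<le> 2\<close> two \<open>p\<close>-summable sequences have an absolutely
  summable product. It vanishes at each even iterate of \<open>x\<close>, because the substitution \<open>n
  \<mapsto> s - 2 * k - n\<close> changes the sign of the sum. It is nonzero unless \<open>x = 0\<close>, so no
  \<open>x\<close> is cyclic for \<open>T\<^sup>2\<close> (\<open>cyclic_square_imp_small_products\<close>).

  For \<open>p > 2\<close> the unweighted shift is a counterexample. Here \<open>c = 1\<close>, so (S) fails and
  the shift is not supercyclic. For the cyclicity of \<open>T ^^ N\<close>, let \<open>a = 1 / sqrt K\<close>,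
  perturb \<open>z\<close> by \<open>a\<close> times a sum of \<open>K\<close> widely spaced backward translates
  of \<open>y\<close>, and apply \<open>a\<close> times the sum of the corresponding \<open>K\<close> iterates.
  The diagonal terms return \<open>y\<close>. If the spacings are proportional to powers of 2, the other
  translates of \<open>y\<close> have disjoint supports, and so have the translates of \<open>z\<close>. Sums of
  \<open>K\<close> disjoint translates have norm of order \<open>K powr (1 / p)\<close> only, and with the
  scalars every error is at most of order \<open>K powr (1 / p - 1 / 2)\<close>, which tends to 0
  (\<open>unweighted_shift_power_cyclic\<close>).
\<close>

section \<open>The Banach space of p-summable sequences\<close>

lemma powr_convex_combination:
  fixes a b u p :: real
  assumes "1 \<le> p" "0 \<le> a" "0 \<le> b" "0 \<le> u" "u \<le> 1"
  shows "((1 - u) * a + u * b) powr p \<le> (1 - u) * a powr p + u * b powr p"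
proof -
  have weight: "v powr p \<le> v" if "0 \<le> v" "v \<le> 1" for v :: real
    using that assms(1) powr_mono'[of 1 p v] by simp
  show ?thesis
  proof (cases "a = 0 \<or> b = 0")
    case True
    then show ?thesis
      using assms weight[of u] weight[of "1 - u"]
      by (auto simp: powr_mult intro!: mult_right_mono)
  next
    case False
    then show ?thesis
      using assms convex_onD[OF powr_convex[OF assms(1)], of u a b] by simp
  qed
qed

lemma lp_norm_nonneg [simp]: "0 \<le> lp_norm p x"
  by (simp add: lp_norm_def)

locale lp_exponent =
  fixes p :: real
  assumes p_ge_1: "1 \<le> p"
begin

lemma finite_sum_le_lp_norm_powr:
  assumes "x \<in> lp p" "finite F"
  shows "(\<Sum>n\<in>F. norm (x n) powr p) \<le> lp_norm p x powr p"
proof -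
  have "(\<Sum>n\<in>F. norm (x n) powr p) \<le> (\<Sum>\<^sub>\<infinity>n. norm (x n) powr p)"
    using assms by (intro finite_sum_le_infsum) (auto simp: lp_def)
  also have "\<dots> = lp_norm p x powr p"
    using p_ge_1 by (simp add: lp_norm_def powr_powr infsum_nonneg)
  finally show ?thesis .
qed

text \<open>
  Membership in the space together with a bound of the norm is a statement about finite partial
  sums; convexity estimates and limits are applied to these sums.
\<close>

lemma lp_norm_leI:
  assumes "0 \<le> r" "\<And>F. finite F \<Longrightarrow> (\<Sum>n\<in>F. norm (x n) powr p) \<le> r powr p"
  shows "x \<in> lp p" "lp_norm p x \<le> r"
proof -
  have s: "(\<lambda>n. norm (x n) powr p) summable_on UNIV"
    by (intro nonneg_bdd_above_summable_on) (auto intro!: bdd_aboveI2 assms)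
  then show "x \<in> lp p"
    by (simp add: lp_def)
  have "(\<Sum>\<^sub>\<infinity>n. norm (x n) powr p) \<le> r powr p"
    by (intro infsum_le_finite_sums s assms)
  then have "lp_norm p x \<le> (r powr p) powr (1 / p)"
    unfolding lp_norm_def using p_ge_1 by (intro powr_mono2) (auto intro: infsum_nonneg)
  then show "lp_norm p x \<le> r"
    using p_ge_1 assms(1) by (simp add: powr_powr)
qed

lemma norm_coord_le_lp_norm:
  assumes "x \<in> lp p"
  shows "norm (x n) \<le> lp_norm p x"
proof -
  have "norm (x n) powr p \<le> lp_norm p x powr p"
    using finite_sum_le_lp_norm_powr[OF assms, of "{n}"] by simp
  then show ?thesis
    using p_ge_1 powr_less_mono2[of p "lp_norm p x" "norm (x n)"] by force
qed

lemma zero_in_lp [simp]: "0 \<in> lp p" and lp_norm_zero [simp]: "lp_norm p 0 = 0"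
  using lp_norm_leI[of 0 0] by (auto intro: antisym)

lemma lp_norm_eq_0_iff:
  assumes "x \<in> lp p"
  shows "lp_norm p x = 0 \<longleftrightarrow> x = 0"
proof
  show "x = 0" if "lp_norm p x = 0"
    using norm_coord_le_lp_norm[OF assms] that by (auto simp: fun_eq_iff)
qed auto

lemma
  assumes "x \<in> lp p"
  shows cscale_in_lp: "cscale a x \<in> lp p"
    and lp_norm_cscale: "lp_norm p (cscale a x) = norm a * lp_norm p x"
proof -
  have le: "cscale a x \<in> lp p \<and> lp_norm p (cscale a x) \<le> norm a * lp_norm p x"
    if x: "x \<in> lp p" for a x
  proof -
    have "(\<Sum>n\<in>F. norm (cscale a x n) powr p) \<le> (norm a * lp_norm p x) powr p" if "finite F" for F
    proof -
      have "(\<Sum>n\<in>F. norm (cscale a x n) powr p) = norm a powr p * (\<Sum>n\<in>F. norm (x n) powr p)"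
        by (simp add: cscale_def norm_mult powr_mult sum_distrib_left)
      also have "\<dots> \<le> norm a powr p * lp_norm p x powr p"
        by (intro mult_left_mono finite_sum_le_lp_norm_powr x that) auto
      finally show ?thesis
        by (simp add: powr_mult)
    qed
    then show ?thesis
      using lp_norm_leI[of "norm a * lp_norm p x" "cscale a x"] by simp
  qed
  from le[OF assms] show ax: "cscale a x \<in> lp p" by blast
  show "lp_norm p (cscale a x) = norm a * lp_norm p x"
  proof (cases "a = 0")
    case True
    then have "cscale a x = 0"
      by (auto simp: cscale_def)
    with True show ?thesis by simp
  next
    case False
    \<comment> \<open>The reverse inequality is the same estimate for the scalar \<open>1 / a\<close>.\<close>
    have "cscale (1 / a) (cscale a x) = x"
      using False by (auto simp: cscale_def)
    then have "lp_norm p x \<le> norm (1 / a) * lp_norm p (cscale a x)"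
      using le[OF ax, of "1 / a"] by simp
    then show ?thesis
      using False le[OF assms, of a] by (simp add: norm_divide field_simps)
  qed
qed

lemma uminus_in_lp: "x \<in> lp p \<Longrightarrow> - x \<in> lp p"
  by (simp add: lp_def)

lemma
  assumes x: "x \<in> lp p" and y: "y \<in> lp p"
  shows add_in_lp: "x + y \<in> lp p"
    and lp_norm_triangle: "lp_norm p (x + y) \<le> lp_norm p x + lp_norm p y"
proof -
  define A where "A = lp_norm p x"
  define B where "B = lp_norm p y"
  have "x + y \<in> lp p \<and> lp_norm p (x + y) \<le> A + B"
  proof (cases "A = 0 \<or> B = 0")
    case True
    then have "x = 0 \<or> y = 0"
      using lp_norm_eq_0_iff x y by (auto simp: A_def B_def)
    then show ?thesis
      using x y by (auto simp: A_def B_def)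
  next
    case False
    then have pos: "0 < A" "0 < B"
      using lp_norm_nonneg[of p x] lp_norm_nonneg[of p y] by (auto simp: A_def B_def less_le)
    define u where "u = B / (A + B)"
    have u: "0 \<le> u" "u \<le> 1" "1 - u = A / (A + B)"
      using pos by (auto simp: u_def field_simps)
    \<comment> \<open>\<open>(x + y) / (A + B)\<close> is the convex combination with weights \<open>1 - u\<close> and \<open>u\<close> of the
       unit vectors \<open>x / A\<close> and \<open>y / B\<close>.\<close>
    have pointwise: "norm ((x + y) n) powr p \<le>
        (A + B) powr p * ((1 - u) * (norm (x n) powr p / A powr p) + u * (norm (y n) powr p / B powr p))"
      for n
    proof -
      have "norm ((x + y) n) \<le> norm (x n) + norm (y n)"
        by (simp add: norm_triangle_ineq)
      also have "\<dots> = (A + B) * ((1 - u) * (norm (x n) / A) + u * (norm (y n) / B))"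
      proof -
        have "(A + B) * (1 - u) = A" "(A + B) * u = B"
          unfolding u(3) using pos by (auto simp: u_def)
        then have "(A + B) * ((1 - u) * (norm (x n) / A)) = A * (norm (x n) / A)"
          "(A + B) * (u * (norm (y n) / B)) = B * (norm (y n) / B)"
          by (metis mult.assoc)+
        then show ?thesis
          using pos by (simp add: distrib_left)
      qed
      finally have "norm ((x + y) n) powr p \<le>
          ((A + B) * ((1 - u) * (norm (x n) / A) + u * (norm (y n) / B))) powr p"
        using p_ge_1 by (intro powr_mono2) auto
      also have "\<dots> = (A + B) powr p * ((1 - u) * (norm (x n) / A) + u * (norm (y n) / B)) powr p"
        by (simp add: powr_mult)
      also have "\<dots> \<le> (A + B) powr p *
          ((1 - u) * (norm (x n) / A) powr p + u * (norm (y n) / B) powr p)"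
        using pos u p_ge_1 by (intro mult_left_mono powr_convex_combination) auto
      finally show ?thesis
        using pos by (simp add: powr_divide)
    qed
    have "(\<Sum>n\<in>F. norm ((x + y) n) powr p) \<le> (A + B) powr p" if F: "finite F" for F
    proof -
      have "(\<Sum>n\<in>F. norm ((x + y) n) powr p) \<le> (\<Sum>n\<in>F. (A + B) powr p *
          ((1 - u) * (norm (x n) powr p / A powr p) + u * (norm (y n) powr p / B powr p)))"
        by (intro sum_mono pointwise)
      also have "\<dots> = (A + B) powr p * ((1 - u) * ((\<Sum>n\<in>F. norm (x n) powr p) / A powr p)
          + u * ((\<Sum>n\<in>F. norm (y n) powr p) / B powr p))"
        by (simp only: sum.distrib flip: sum_distrib_left sum_divide_distrib)
      also have "\<dots> \<le> (A + B) powr p * ((1 - u) * 1 + u * 1)"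
        using u pos finite_sum_le_lp_norm_powr[OF x F] finite_sum_le_lp_norm_powr[OF y F]
        by (intro mult_left_mono add_mono) (auto simp: A_def B_def divide_le_eq_1)
      finally show ?thesis
        by simp
    qed
    then show ?thesis
      using pos lp_norm_leI[of "A + B" "x + y"] by auto
  qed
  then show "x + y \<in> lp p" "lp_norm p (x + y) \<le> lp_norm p x + lp_norm p y"
    by (auto simp: A_def B_def)
qed

lemma diff_in_lp:
  assumes "x \<in> lp p" "y \<in> lp p"
  shows "x - y \<in> lp p"
  using add_in_lp[OF assms(1) uminus_in_lp[OF assms(2)]] by simp

lemma lp_norm_minus_commute: "lp_norm p (x - y) = lp_norm p (y - x)"
  by (simp add: lp_norm_def norm_minus_commute)

lemma lp_norm_diff_triangle:
  assumes "x \<in> lp p" "y \<in> lp p" "z \<in> lp p"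
  shows "lp_norm p (x - z) \<le> lp_norm p (x - y) + lp_norm p (y - z)"
  using lp_norm_triangle[OF diff_in_lp[OF assms(1,2)] diff_in_lp[OF assms(2,3)]]
  by simp

lemma sum_in_lp: "(\<And>i. i \<in> I \<Longrightarrow> f i \<in> lp p) \<Longrightarrow> sum f I \<in> lp p"
  by (induction I rule: infinite_finite_induct) (simp_all add: add_in_lp)

lemma lp_norm_sum_le:
  assumes "\<And>i. i \<in> I \<Longrightarrow> f i \<in> lp p"
  shows "lp_norm p (sum f I) \<le> (\<Sum>i\<in>I. lp_norm p (f i))"
  using assms
proof (induction I rule: infinite_finite_induct)
  case (insert i I)
  have "lp_norm p (f i + sum f I) \<le> lp_norm p (f i) + lp_norm p (sum f I)"
    by (intro lp_norm_triangle sum_in_lp insert.prems) auto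
  moreover have "lp_norm p (sum f I) \<le> (\<Sum>i\<in>I. lp_norm p (f i))"
    by (intro insert.IH insert.prems) auto
  ultimately show ?case
    unfolding sum.insert[OF insert.hyps] by linarith
qed simp_all

lemma subspace_lp: "cfun.subspace (lp p)"
  by (auto simp: cfun.subspace_def add_in_lp cscale_in_lp)

sublocale lp: Metric_space "lp p" "\<lambda>x y. lp_norm p (x - y)"
proof
  fix x y z :: "int \<Rightarrow> complex"
  show "lp_norm p (x - y) = 0 \<longleftrightarrow> x = y" if "x \<in> lp p" "y \<in> lp p"
    unfolding lp_norm_eq_0_iff[OF diff_in_lp[OF that]] by (rule right_minus_eq)
  show "lp_norm p (x - y) = lp_norm p (y - x)"
    by (rule lp_norm_minus_commute)
qed (rule lp_norm_nonneg lp_norm_diff_triangle; assumption)+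

lemma mcomplete_lp: "lp.mcomplete"
  unfolding lp.mcomplete_def
proof (intro allI impI)
  fix X :: "nat \<Rightarrow> int \<Rightarrow> complex"
  assume "lp.MCauchy X"
  then have X: "\<And>k. X k \<in> lp p"
    and cauchy: "\<And>e. 0 < e \<Longrightarrow> \<exists>N. \<forall>k\<ge>N. \<forall>l\<ge>N. lp_norm p (X k - X l) < e"
    unfolding lp.MCauchy_def by (blast, metis)
  have "Cauchy (\<lambda>k. X k n)" for n
    unfolding Cauchy_def dist_norm
  proof (intro allI impI)
    fix e :: real
    assume "0 < e"
    then obtain N where N: "\<forall>k\<ge>N. \<forall>l\<ge>N. lp_norm p (X k - X l) < e"
      using cauchy by blast
    have "norm (X k n - X l n) < e" if "k \<ge> N" "l \<ge> N" for k l
      using norm_coord_le_lp_norm[OF diff_in_lp[OF X X], of k l n] N that by force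
    then show "\<exists>N. \<forall>k\<ge>N. \<forall>l\<ge>N. norm (X k n - X l n) < e"
      by blast
  qed
  then obtain x where x: "(\<lambda>k. X k n) \<longlonglongrightarrow> x n" for n
    unfolding Cauchy_convergent_iff convergent_def by metis
  have tail: "\<exists>N. \<forall>k\<ge>N. X k - x \<in> lp p \<and> lp_norm p (X k - x) \<le> e" if e: "0 < e" for e
  proof -
    obtain N where N: "\<forall>k\<ge>N. \<forall>l\<ge>N. lp_norm p (X k - X l) < e"
      using cauchy[OF e] by blast
    have "(\<Sum>n\<in>F. norm ((X k - x) n) powr p) \<le> e powr p" if k: "k \<ge> N" and F: "finite F" for k F
    proof (rule LIMSEQ_le_const2)
      show "(\<lambda>l. \<Sum>n\<in>F. norm ((X k - X l) n) powr p) \<longlonglongrightarrow> (\<Sum>n\<in>F. norm ((X k - x) n) powr p)"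
        using p_ge_1 by (auto intro!: tendsto_sum tendsto_powr' tendsto_norm tendsto_diff tendsto_const x)
      have "(\<Sum>n\<in>F. norm ((X k - X l) n) powr p) \<le> e powr p" if "l \<ge> N" for l
      proof -
        have "(\<Sum>n\<in>F. norm ((X k - X l) n) powr p) \<le> lp_norm p (X k - X l) powr p"
          by (intro finite_sum_le_lp_norm_powr diff_in_lp X F)
        also have "\<dots> \<le> e powr p"
          using N k that p_ge_1 by (intro powr_mono2) (auto intro: less_imp_le)
        finally show ?thesis .
      qed
      then show "\<exists>N. \<forall>l\<ge>N. (\<Sum>n\<in>F. norm ((X k - X l) n) powr p) \<le> e powr p"
        by blast
    qed
    then show ?thesis
      using lp_norm_leI[of e] e by (meson less_imp_le)
  qed
  obtain N where "X N - x \<in> lp p"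
    using tail[OF zero_less_one] by blast
  then have "X N - (X N - x) \<in> lp p"
    by (rule diff_in_lp[OF X])
  moreover have "X N - (X N - x) = x"
    by (rule ext) simp
  ultimately have xp: "x \<in> lp p"
    by simp
  have "limitin lp.mtopology X x sequentially"
    unfolding lp.limitin_metric
  proof (intro conjI allI impI xp)
    fix e :: real
    assume "0 < e"
    then obtain N where "\<forall>k\<ge>N. lp_norm p (X k - x) \<le> e / 2"
      using tail[of "e / 2"] by auto
    with \<open>0 < e\<close> have "\<forall>k\<ge>N. X k \<in> lp p \<and> lp_norm p (X k - x) < e"
      using X by force
    then show "\<forall>\<^sub>F k in sequentially. X k \<in> lp p \<and> lp_norm p (X k - x) < e"
      unfolding eventually_sequentially by blast
  qed
  then show "\<exists>x. limitin lp.mtopology X x sequentially"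
    by blast
qed

end

section \<open>Finitely supported sequences\<close>

definition c00 :: "(int \<Rightarrow> complex) set" where
  "c00 = {x. finite {n. x n \<noteq> 0}}"

lemma c00I: "finite F \<Longrightarrow> (\<And>n. n \<notin> F \<Longrightarrow> x n = 0) \<Longrightarrow> x \<in> c00"
  unfolding c00_def by (auto elim!: finite_subset[rotated])

lemma sum_fun_apply: "(\<Sum>i\<in>I. f i) n = (\<Sum>i\<in>I. f i n)"
  by (induction I rule: infinite_finite_induct) auto

lemma cscale_apply [simp]: "cscale a x n = a * x n"
  by (simp add: cscale_def)

lemma basis_expansion:
  assumes "finite F" "\<And>n. n \<notin> F \<Longrightarrow> x n = 0"
  shows "x = (\<Sum>n\<in>F. cscale (x n) (basis_vec n))"
proof
  fix k
  have "(\<Sum>n\<in>F. x n * basis_vec n k) = (\<Sum>n\<in>F. if n = k then x n else 0)"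
    by (intro sum.cong) (auto simp: basis_vec_def)
  then show "x k = (\<Sum>n\<in>F. cscale (x n) (basis_vec n)) k"
    using assms by (auto simp: sum_fun_apply)
qed

context lp_exponent
begin

lemma
  shows basis_vec_in_lp: "basis_vec n \<in> lp p"
    and lp_norm_basis_vec_le: "lp_norm p (basis_vec n) \<le> 1"
proof -
  have "(\<Sum>k\<in>F. norm (basis_vec n k) powr p) \<le> 1 powr p" if F: "finite F" for F
  proof -
    have "(\<Sum>k\<in>F. norm (basis_vec n k) powr p) = (\<Sum>k\<in>F. if k = n then 1 else 0)"
      using p_ge_1 by (intro sum.cong) (auto simp: basis_vec_def)
    then show ?thesis
      using F by simp
  qed
  then show "basis_vec n \<in> lp p" "lp_norm p (basis_vec n) \<le> 1"
    using lp_norm_leI[of 1 "basis_vec n"] by auto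
qed

lemma
  assumes "finite F" "\<And>n. n \<notin> F \<Longrightarrow> x n = 0"
  shows finite_support_in_lp: "x \<in> lp p"
    and lp_norm_finite_support_le: "lp_norm p x \<le> (\<Sum>n\<in>F. norm (x n))"
proof -
  let ?t = "\<lambda>n. cscale (x n) (basis_vec n)"
  have x: "x = (\<Sum>n\<in>F. ?t n)"
    by (rule basis_expansion[OF assms])
  have t: "?t n \<in> lp p" for n
    by (intro cscale_in_lp basis_vec_in_lp)
  have "(\<Sum>n\<in>F. ?t n) \<in> lp p"
    by (intro sum_in_lp t)
  with x show "x \<in> lp p"
    by metis
  have "lp_norm p (\<Sum>n\<in>F. ?t n) \<le> (\<Sum>n\<in>F. lp_norm p (?t n))"
    by (intro lp_norm_sum_le t)
  also have "\<dots> \<le> (\<Sum>n\<in>F. norm (x n))"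
    using lp_norm_basis_vec_le
    by (intro sum_mono) (simp add: lp_norm_cscale basis_vec_in_lp mult_left_le)
  finally show "lp_norm p x \<le> (\<Sum>n\<in>F. norm (x n))"
    using x by metis
qed

lemma c00_in_lp: "x \<in> c00 \<Longrightarrow> x \<in> lp p"
  by (rule finite_support_in_lp[of "{n. x n \<noteq> 0}"]) (auto simp: c00_def)

lemma c00_dense:
  assumes "x \<in> lp p" "0 < e"
  obtains z where "z \<in> c00" "lp_norm p (x - z) < e"
proof -
  let ?f = "\<lambda>n. norm (x n) powr p"
  have s: "?f summable_on UNIV"
    using assms(1) by (simp add: lp_def)
  have "0 < (e / 2) powr p"
    using assms by simp
  then obtain F where F: "finite F" "dist (sum ?f F) (infsum ?f UNIV) \<le> (e / 2) powr p"
    using infsum_finite_approximation[OF s] by blast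
  define z where "z = (\<lambda>n. if n \<in> F then x n else 0)"
  have "(\<Sum>n\<in>G. norm ((x - z) n) powr p) \<le> (e / 2) powr p" if G: "finite G" for G
  proof -
    have "(\<Sum>n\<in>G. norm ((x - z) n) powr p) = sum ?f (G - F)"
      using G by (intro sum.mono_neutral_cong_right) (auto simp: z_def)
    also have "\<dots> = sum ?f (G \<union> F) - sum ?f F"
      using sum.union_disjoint[of "G - F" F ?f] G F by (simp add: Un_Diff_cancel2 Diff_Int_distrib2)
    also have "\<dots> \<le> infsum ?f UNIV - sum ?f F"
      using G F by (intro diff_right_mono finite_sum_le_infsum s) auto
    also have "\<dots> \<le> (e / 2) powr p"
      using F(2) by (auto simp: dist_real_def)
    finally show ?thesis .
  qed
  then have "lp_norm p (x - z) \<le> e / 2"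
    using assms(2) by (intro lp_norm_leI) auto
  moreover have "z \<in> c00"
    using F(1) by (rule c00I) (auto simp: z_def)
  ultimately show thesis
    using assms(2) by (intro that[of z]) auto
qed

text \<open>
  The dense set consists of the finitely supported vectors with coordinates in a countable dense
  subset of the complex plane.
\<close>

lemma separable:
  obtains D where "countable D" "D \<subseteq> c00"
    "\<And>x e. x \<in> lp p \<Longrightarrow> 0 < e \<Longrightarrow> \<exists>d\<in>D. lp_norm p (x - d) < e"
proof -
  obtain B :: "complex set" where B: "countable B"
    "\<And>X. open X \<Longrightarrow> X \<noteq> {} \<Longrightarrow> \<exists>b\<in>B. b \<in> X"
    using countable_dense_setE by blast
  define ext0 where "ext0 = (\<lambda>(F :: int set) (g :: int \<Rightarrow> complex) n. if n \<in> F then g n else 0)"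
  define D where "D = (\<Union>F\<in>{F. finite F}. ext0 F ` (F \<rightarrow>\<^sub>E B))"
  have D_countable: "countable D"
    unfolding D_def
  proof (intro countable_UN countable_Collect_finite countable_image)
    show "countable (F \<rightarrow>\<^sub>E B)" if "F \<in> {F. finite F}" for F :: "int set"
      using that B(1) by (intro countable_PiE) auto
  qed
  have D_c00: "D \<subseteq> c00"
  proof -
    have "ext0 F g \<in> c00" if "finite F" for F g
      using that by (rule c00I) (simp add: ext0_def)
    then show ?thesis
      by (auto simp: D_def)
  qed
  have "\<exists>d\<in>D. lp_norm p (x - d) < e" if x: "x \<in> lp p" "0 < e" for x e
  proof -
    obtain z where z: "z \<in> c00" "lp_norm p (x - z) < e / 2"
      using c00_dense[OF x(1), of "e / 2"] x(2) by auto
    define F where "F = {n. z n \<noteq> 0}"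
    have F: "finite F"
      using z by (simp add: F_def c00_def)
    define r where "r = e / (2 * (real (card F) + 1))"
    have r: "0 < r" "card F * r < e / 2"
      using x(2) by (auto simp: r_def field_simps)
    have "\<exists>b\<in>B. b \<in> ball (z n) r" for n
      using B(2)[of "ball (z n) r"] r by auto
    then obtain g where g: "\<And>n. g n \<in> B" "\<And>n. dist (z n) (g n) < r"
      by (metis mem_ball)
    define d where "d = ext0 F (restrict g F)"
    have d: "d \<in> D"
      unfolding D_def d_def using F g(1) by auto
    have "lp_norm p (z - d) \<le> (\<Sum>n\<in>F. norm ((z - d) n))"
      using F by (intro lp_norm_finite_support_le) (auto simp: d_def ext0_def F_def)
    also have "\<dots> \<le> (\<Sum>n\<in>F. r)"
      using g(2) by (intro sum_mono) (auto simp: d_def ext0_def dist_norm intro: less_imp_le)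
    also have "\<dots> < e / 2"
      using r by simp
    finally have zd: "lp_norm p (z - d) < e / 2" .
    have "lp_norm p (x - d) \<le> lp_norm p (x - z) + lp_norm p (z - d)"
      using x(1) z(1) d D_c00 c00_in_lp by (intro lp_norm_diff_triangle) auto
    also have "\<dots> < e"
      using z(2) zd by linarith
    finally have "lp_norm p (x - d) < e" .
    with d show ?thesis
      by blast
  qed
  with D_countable D_c00 that show thesis
    by blast
qed

section \<open>Universal vectors\<close>

lemma lp_bounded_linear_diff:
  assumes "lp_bounded_linear p L" "x \<in> lp p" "y \<in> lp p"
  shows "L (x - y) = L x - L y"
proof -
  have eq: "u - v = u + cscale (- 1) v" for u v :: "int \<Rightarrow> complex"
    by (simp add: fun_eq_iff)
  have "L (x + cscale (- 1) y) = L x + cscale (- 1) (L y)"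
    using assms cscale_in_lp[of y "- 1"] unfolding lp_bounded_linear_def by metis
  then show ?thesis
    by (simp only: eq)
qed

lemma lp_bounded_linear_bound:
  assumes "lp_bounded_linear p L"
  obtains C where "0 < C" "\<And>x. x \<in> lp p \<Longrightarrow> lp_norm p (L x) \<le> C * lp_norm p x"
proof -
  obtain C where C: "\<And>x. x \<in> lp p \<Longrightarrow> lp_norm p (L x) \<le> C * lp_norm p x"
    using assms unfolding lp_bounded_linear_def by blast
  have "lp_norm p (L x) \<le> (\<bar>C\<bar> + 1) * lp_norm p x" if "x \<in> lp p" for x
    using C[OF that] by (rule order_trans) (intro mult_right_mono, auto)
  then show thesis
    by (intro that[of "\<bar>C\<bar> + 1"]) auto
qed

text \<open>
  The Baire category theorem turns approximate solutions into a single vector: for each target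
  \<open>d\<close> from a countable dense set and each precision, the vectors some member of the family sends
  that close to \<open>d\<close> form an open set, which is dense by hypothesis.
\<close>

lemma universal_vector_exists:
  assumes lin: "\<And>L. L \<in> \<F> \<Longrightarrow> lp_bounded_linear p L"
    and step: "\<And>z y e. \<lbrakk>z \<in> c00; y \<in> c00; 0 < e\<rbrakk> \<Longrightarrow>
      \<exists>x\<in>lp p. \<exists>L\<in>\<F>. lp_norm p (x - z) < e \<and> lp_norm p (L x - y) < e"
  obtains x where "x \<in> lp p" "lp_dense p {L x |L. L \<in> \<F>}"
proof -
  obtain D where D: "countable D" "D \<subseteq> c00"
    and D_dense: "\<And>x e. x \<in> lp p \<Longrightarrow> 0 < e \<Longrightarrow> \<exists>d\<in>D. lp_norm p (x - d) < e"
    using separable by metis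
  have L_in: "L x \<in> lp p" if "L \<in> \<F>" "x \<in> lp p" for L x
    using lin that by (auto simp: lp_bounded_linear_def)
  define G where "G = (\<lambda>(d, k::nat). {x \<in> lp p. \<exists>L\<in>\<F>. lp_norm p (L x - d) < 1 / Suc k})"
  have G_open: "openin lp.mtopology (G (d, k))" if d: "d \<in> D" for d k
    unfolding lp.openin_mtopology
  proof (intro conjI allI impI)
    fix x
    assume "x \<in> G (d, k)"
    then obtain L where x: "x \<in> lp p" and L: "L \<in> \<F>" "lp_norm p (L x - d) < 1 / Suc k"
      by (auto simp: G_def)
    obtain C where C: "0 < C" "\<And>u. u \<in> lp p \<Longrightarrow> lp_norm p (L u) \<le> C * lp_norm p u"
      using lp_bounded_linear_bound[OF lin[OF L(1)]] by blast
    define r where "r = (1 / Suc k - lp_norm p (L x - d)) / C"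
    have "0 < r"
      using L(2) C(1) by (simp add: r_def)
    moreover have "u \<in> G (d, k)" if u: "u \<in> lp p" "lp_norm p (x - u) < r" for u
    proof -
      have "lp_norm p (L u - d) \<le> lp_norm p (L u - L x) + lp_norm p (L x - d)"
        using d D c00_in_lp L_in L(1) u(1) x by (intro lp_norm_diff_triangle) auto
      also have "\<dots> < C * r + lp_norm p (L x - d)"
      proof (rule add_strict_right_mono)
        have "lp_norm p (L u - L x) = lp_norm p (L (x - u))"
          using lp_bounded_linear_diff[OF lin[OF L(1)] x u(1)] lp_norm_minus_commute by metis
        also have "\<dots> \<le> C * lp_norm p (x - u)"
          using diff_in_lp[OF x u(1)] by (rule C)
        also have "\<dots> < C * r"
          using u C by simp
        finally show "lp_norm p (L u - L x) < C * r" .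
      qed
      also have "C * r + lp_norm p (L x - d) = 1 / Suc k"
        using C(1) by (simp add: r_def)
      finally show ?thesis
        using u(1) L(1) unfolding G_def by blast
    qed
    then have "lp.mball x r \<subseteq> G (d, k)"
      by (auto simp: lp.in_mball)
    ultimately show "\<exists>r>0. lp.mball x r \<subseteq> G (d, k)"
      by blast
  qed (auto simp: G_def)
  have G_dense: "lp.mtopology closure_of G (d, k) = lp p" if d: "d \<in> D" for d k
  proof -
    have "\<exists>x\<in>G (d, k). x \<in> lp.mball v r" if v: "v \<in> lp p" and r: "0 < r" for v r
    proof -
      obtain z where z: "z \<in> c00" "lp_norm p (v - z) < r / 2"
        using c00_dense[OF v, of "r / 2"] r by auto
      define e where "e = min (r / 2) (1 / Suc k)"
      have "0 < e"
        using r by (simp add: e_def)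
      then obtain x L where x: "x \<in> lp p" "L \<in> \<F>" "lp_norm p (x - z) < e" "lp_norm p (L x - d) < e"
        using step[OF z(1), of d e] d D by blast
      have "lp_norm p (v - x) \<le> lp_norm p (v - z) + lp_norm p (z - x)"
        using v x z c00_in_lp by (intro lp_norm_diff_triangle) auto
      also have "\<dots> < r / 2 + r / 2"
        using z x lp_norm_minus_commute[of z x] by (intro add_strict_mono) (auto simp: e_def)
      finally have "x \<in> lp.mball v r"
        using v x by (auto simp: lp.in_mball)
      moreover have "x \<in> G (d, k)"
        using x unfolding G_def e_def by auto
      ultimately show ?thesis
        by blast
    qed
    then show ?thesis
      unfolding lp.metric_closure_of by blast
  qed
  have "lp.mtopology closure_of \<Inter>(G ` (D \<times> UNIV)) = lp p"
    using D(1) G_open G_dense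
    by (intro lp.metric_Baire_category mcomplete_lp countable_image countable_SIGMA) auto
  then have "\<Inter>(G ` (D \<times> UNIV)) \<noteq> {}"
    using zero_in_lp by (metis closure_of_empty empty_iff)
  moreover have "D \<noteq> {}"
    using D_dense[OF zero_in_lp zero_less_one] by blast
  ultimately obtain x where "x \<in> \<Inter>(G ` (D \<times> UNIV))" "D \<noteq> {}"
    by blast
  then have x: "x \<in> lp p" "\<And>d k. d \<in> D \<Longrightarrow> x \<in> G (d, k)"
    by (auto simp: G_def)
  have "\<exists>s\<in>{L x |L. L \<in> \<F>}. lp_norm p (y - s) < e" if y: "y \<in> lp p" "0 < e" for y e
  proof -
    obtain d where d: "d \<in> D" "lp_norm p (y - d) < e / 2"
      using D_dense[OF y(1), of "e / 2"] y(2) by auto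
    obtain k where k: "1 / Suc k < e / 2"
      using nat_approx_posE[of "e / 2"] y(2) by auto
    obtain L where L: "L \<in> \<F>" "lp_norm p (L x - d) < 1 / Suc k"
      using x(2)[OF d(1), of k] by (auto simp: G_def)
    have "lp_norm p (y - L x) \<le> lp_norm p (y - d) + lp_norm p (d - L x)"
      using y d D c00_in_lp L_in L x by (intro lp_norm_diff_triangle) auto
    also have "\<dots> < e"
      using d L k lp_norm_minus_commute[of d "L x"] by linarith
    finally show ?thesis
      using L(1) by blast
  qed
  then have "lp_dense p {L x |L. L \<in> \<F>}"
    using L_in x(1) by (auto simp: lp_dense_def)
  with x(1) that show thesis
    by blast
qed

end

section \<open>Weighted shifts as translations\<close>

context lp_exponent
begin

lemma lp_bounded_linearI:
  assumes "\<And>x. x \<in> lp p \<Longrightarrow> L x \<in> lp p"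
    and "\<And>x y. x \<in> lp p \<Longrightarrow> y \<in> lp p \<Longrightarrow> L (x + y) = L x + L y"
    and "\<And>a x. x \<in> lp p \<Longrightarrow> L (cscale a x) = cscale a (L x)"
    and "\<And>x. x \<in> lp p \<Longrightarrow> lp_norm p (L x) \<le> C * lp_norm p x"
  shows "lp_bounded_linear p L"
  using assms unfolding lp_bounded_linear_def by blast

lemma
  assumes "lp_bounded_linear p L" "x \<in> lp p"
  shows lp_bounded_linear_in_lp: "L x \<in> lp p"
    and lp_bounded_linear_scale: "L (cscale a x) = cscale a (L x)"
    and lp_bounded_linear_plus: "y \<in> lp p \<Longrightarrow> L (x + y) = L x + L y"
  using assms unfolding lp_bounded_linear_def by blast+

lemma lp_bounded_linear_id: "lp_bounded_linear p (\<lambda>x. x)"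
  by (auto simp: lp_bounded_linear_def intro!: exI[of _ 1])

lemma lp_bounded_linear_compose:
  assumes "lp_bounded_linear p L" "lp_bounded_linear p L'"
  shows "lp_bounded_linear p (\<lambda>x. L (L' x))"
proof -
  note L = lp_bounded_linear_in_lp[OF assms(1)] and L' = lp_bounded_linear_in_lp[OF assms(2)]
  obtain C where C: "0 < C" "\<And>x. x \<in> lp p \<Longrightarrow> lp_norm p (L x) \<le> C * lp_norm p x"
    using lp_bounded_linear_bound[OF assms(1)] by blast
  obtain C' where C': "0 < C'" "\<And>x. x \<in> lp p \<Longrightarrow> lp_norm p (L' x) \<le> C' * lp_norm p x"
    using lp_bounded_linear_bound[OF assms(2)] by blast
  show ?thesis
  proof (rule lp_bounded_linearI)
    fix x y a
    assume x: "x \<in> lp p"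
    show "L (L' x) \<in> lp p"
      by (intro L L' x)
    show "L (L' (x + y)) = L (L' x) + L (L' y)" if "y \<in> lp p"
      unfolding lp_bounded_linear_plus[OF assms(2) x that]
      by (rule lp_bounded_linear_plus[OF assms(1) L'[OF x] L'[OF that]])
    show "L (L' (cscale a x)) = cscale a (L (L' x))"
      unfolding lp_bounded_linear_scale[OF assms(2) x]
      by (rule lp_bounded_linear_scale[OF assms(1) L'[OF x]])
    have "lp_norm p (L (L' x)) \<le> C * lp_norm p (L' x)"
      by (intro C L' x)
    also have "\<dots> \<le> C * (C' * lp_norm p x)"
      using C(1) C'(2)[OF x] by (intro mult_left_mono) auto
    finally show "lp_norm p (L (L' x)) \<le> (C * C') * lp_norm p x"
      by (simp add: mult.assoc)
  qed
qed

lemma lp_bounded_linear_funpow: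
  assumes "lp_bounded_linear p L"
  shows "lp_bounded_linear p (L ^^ n)"
proof (induction n)
  case 0
  show ?case
    using lp_bounded_linear_id by (simp add: id_def)
next
  case (Suc n)
  show ?case
    using lp_bounded_linear_compose[OF assms Suc.IH] by (simp add: o_def)
qed

lemma lp_bounded_linear_cscale: "lp_bounded_linear p (cscale a)"
  by (rule lp_bounded_linearI[where C = "norm a"])
    (simp_all add: cscale_in_lp lp_norm_cscale cfun.scale_right_distrib mult.commute)

lemma lp_bounded_linear_add:
  assumes "lp_bounded_linear p L" "lp_bounded_linear p L'"
  shows "lp_bounded_linear p (\<lambda>x. L x + L' x)"
proof -
  note L = lp_bounded_linear_in_lp[OF assms(1)] and L' = lp_bounded_linear_in_lp[OF assms(2)]
  obtain C where C: "0 < C" "\<And>x. x \<in> lp p \<Longrightarrow> lp_norm p (L x) \<le> C * lp_norm p x"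
    using lp_bounded_linear_bound[OF assms(1)] by blast
  obtain C' where C': "0 < C'" "\<And>x. x \<in> lp p \<Longrightarrow> lp_norm p (L' x) \<le> C' * lp_norm p x"
    using lp_bounded_linear_bound[OF assms(2)] by blast
  show ?thesis
  proof (rule lp_bounded_linearI)
    fix x y a
    assume x: "x \<in> lp p"
    show "L x + L' x \<in> lp p"
      by (intro add_in_lp L L' x)
    show "L (x + y) + L' (x + y) = (L x + L' x) + (L y + L' y)" if "y \<in> lp p"
      unfolding lp_bounded_linear_plus[OF assms(1) x that] lp_bounded_linear_plus[OF assms(2) x that]
      by (simp only: ac_simps)
    show "L (cscale a x) + L' (cscale a x) = cscale a (L x + L' x)"
      unfolding lp_bounded_linear_scale[OF assms(1) x] lp_bounded_linear_scale[OF assms(2) x]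
      by (rule cfun.scale_right_distrib[symmetric])
    have "lp_norm p (L x + L' x) \<le> lp_norm p (L x) + lp_norm p (L' x)"
      by (intro lp_norm_triangle L L' x)
    also have "\<dots> \<le> C * lp_norm p x + C' * lp_norm p x"
      by (intro add_mono C C' x)
    finally show "lp_norm p (L x + L' x) \<le> (C + C') * lp_norm p x"
      by (simp add: distrib_right)
  qed
qed

text \<open>
  A bounded operator is determined by its values on the basis vectors, so a weighted shift is
  given by the coordinate formula on the whole space.
\<close>

lemma weighted_bilateral_shift_apply:
  assumes T: "weighted_bilateral_shift p w T" and x: "x \<in> lp p"
  shows "T x = (\<lambda>n. w (n + 1) * x (n + 1))"
proof -
  define T' where "T' = (\<lambda>(x::int \<Rightarrow> complex) n. w (n + 1) * x (n + 1))"
  have T': "weighted_bilateral_shift p w T'"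
    unfolding T'_def using T p_ge_1
    by (intro weighted_bilateral_shift_coords) (auto simp: weighted_bilateral_shift_def)
  have lin: "lp_bounded_linear p T" "lp_bounded_linear p T'"
    using T T' by (auto simp: weighted_bilateral_shift_def)
  have T_in: "T u \<in> lp p" "T' u \<in> lp p" if "u \<in> lp p" for u
    using lin that by (auto simp: lp_bounded_linear_def)
  have agree_on_sums: "T (\<Sum>n\<in>F. cscale (u n) (basis_vec n)) = T' (\<Sum>n\<in>F. cscale (u n) (basis_vec n))"
    if "finite F" for F u
    using that
  proof (induction F rule: finite_induct)
    case empty
    have "L 0 = 0" if "lp_bounded_linear p L" for L
      using lp_bounded_linear_scale[OF that zero_in_lp, of 0] by (simp only: cfun.scale_zero_left)
    with lin show ?case
      by (simp only: sum.empty)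
  next
    case (insert n F)
    let ?e = "cscale (u n) (basis_vec n)"
    let ?s = "\<Sum>n\<in>F. cscale (u n) (basis_vec n)"
    have e: "?e \<in> lp p" "?s \<in> lp p"
      by (intro cscale_in_lp basis_vec_in_lp sum_in_lp)+
    have "T ?e = T' ?e"
      using lin T T' basis_vec_in_lp unfolding lp_bounded_linear_def weighted_bilateral_shift_def
      by metis
    moreover have "T (?e + ?s) = T ?e + T ?s" "T' (?e + ?s) = T' ?e + T' ?s"
      using lin e unfolding lp_bounded_linear_def by blast+
    ultimately show ?case
      using insert.IH unfolding sum.insert[OF insert.hyps] by metis
  qed
  have agree: "T z = T' z" if "z \<in> c00" for z
  proof -
    have F: "finite {n. z n \<noteq> 0}"
      using that by (simp add: c00_def)
    show ?thesis
      using agree_on_sums[OF F, of z] basis_expansion[OF F, of z] by simp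
  qed
  obtain C where C: "0 < C" "\<And>x. x \<in> lp p \<Longrightarrow> lp_norm p (T x) \<le> C * lp_norm p x"
    using lp_bounded_linear_bound[OF lin(1)] by blast
  obtain C' where C': "0 < C'" "\<And>x. x \<in> lp p \<Longrightarrow> lp_norm p (T' x) \<le> C' * lp_norm p x"
    using lp_bounded_linear_bound[OF lin(2)] by blast
  have "lp_norm p (T x - T' x) \<le> 0 + e" if e: "0 < e" for e
  proof -
    obtain z where z: "z \<in> c00" "lp_norm p (x - z) < e / (C + C')"
      using c00_dense[OF x, of "e / (C + C')"] e C(1) C'(1) by auto
    have xz: "x - z \<in> lp p"
      by (rule diff_in_lp[OF x c00_in_lp[OF z(1)]])
    have "lp_norm p (T x - T' x) \<le> lp_norm p (T x - T z) + lp_norm p (T z - T' x)"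
      using T_in x c00_in_lp[OF z(1)] by (intro lp_norm_diff_triangle) auto
    also have "T x - T z = T (x - z)"
      by (rule lp_bounded_linear_diff[OF lin(1) x c00_in_lp[OF z(1)], symmetric])
    also have "lp_norm p (T z - T' x) = lp_norm p (T' x - T' z)"
      unfolding agree[OF z(1)] by (rule lp_norm_minus_commute)
    also have "T' x - T' z = T' (x - z)"
      by (rule lp_bounded_linear_diff[OF lin(2) x c00_in_lp[OF z(1)], symmetric])
    also have "lp_norm p (T (x - z)) + lp_norm p (T' (x - z)) \<le>
        C * lp_norm p (x - z) + C' * lp_norm p (x - z)"
      by (intro add_mono C C' xz)
    also have "\<dots> = (C + C') * lp_norm p (x - z)"
      by (rule distrib_right[symmetric])
    also have "\<dots> \<le> (C + C') * (e / (C + C'))"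
      using z(2) C(1) C'(1) by (intro mult_left_mono) auto
    also have "\<dots> = 0 + e"
      using C(1) C'(1) by simp
    finally show ?thesis .
  qed
  then have "lp_norm p (T x - T' x) = 0"
    using field_le_epsilon[of "lp_norm p (T x - T' x)" 0] by (simp add: antisym)
  then have "T x = T' x"
    using lp.zero[OF T_in(1)[OF x] T_in(2)[OF x]] by blast
  then show ?thesis
    by (simp add: T'_def)
qed

end

text \<open>
  In terms of the rescaled coordinates \<open>x n / c n\<close> the operator \<open>translate c k\<close> is the translation by
  \<open>k\<close>.
\<close>

definition translate :: "(int \<Rightarrow> complex) \<Rightarrow> int \<Rightarrow> (int \<Rightarrow> complex) \<Rightarrow> int \<Rightarrow> complex" where
  "translate c k x = (\<lambda>n. c n / c (n + k) * x (n + k))"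

lemma translate_add: "translate c k (x + y) = translate c k x + translate c k y"
  by (rule ext) (simp add: translate_def algebra_simps)

lemma translate_cscale: "translate c k (cscale a x) = cscale a (translate c k x)"
  by (rule ext) (simp add: translate_def)

lemma translate_translate:
  assumes "\<And>n. c n \<noteq> 0"
  shows "translate c j (translate c k x) = translate c (j + k) x"
  using assms by (auto simp: translate_def fun_eq_iff field_simps)

lemma translate_0: "(\<And>n. c n \<noteq> 0) \<Longrightarrow> translate c 0 x = x"
  by (simp add: translate_def)

text \<open>
  The products of consecutive weights that occur in the powers of the shift are the quotients
  \<open>c (n - k) / c n\<close>.
\<close>

lemma weight_potential_exists:
  fixes w :: "int \<Rightarrow> complex"
  assumes "\<And>n. w n \<noteq> 0"
  obtains c where "\<And>n. c n \<noteq> 0" "\<And>n. c (n - 1) = w n * c n"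
proof -
  define c where "c = (\<lambda>n. if 0 \<le> n then \<Prod>i\<in>{1..n}. inverse (w i) else \<Prod>i\<in>{n+1..0}. w i)"
  have "c (n - 1) = w n * c n" for n
  proof (cases "1 \<le> n")
    case True
    then have "{1..n} = insert n {1..n - 1}"
      by auto
    with True show ?thesis
      using assms[of n] by (simp add: c_def)
  next
    case False
    then have "{n..0} = insert n {n + 1..0}"
      by auto
    with False show ?thesis
      by (auto simp: c_def)
  qed
  moreover have "c n \<noteq> 0" for n
    using assms by (simp add: c_def)
  ultimately show thesis
    using that by blast
qed

text \<open>
  The weights themselves enter the arguments only through \<open>c\<close>; their boundedness becomes the growth
  bound with the constant \<open>M\<close>.
\<close>

locale translation_shift = lp_exponent +
  fixes T :: "(int \<Rightarrow> complex) \<Rightarrow> int \<Rightarrow> complex" and c :: "int \<Rightarrow> complex" and M :: real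
  assumes c_nonzero: "\<And>n. c n \<noteq> 0"
    and M_ge_1: "1 \<le> M"
    and c_step: "\<And>n. norm (c (n - 1)) \<le> M * norm (c n)"
    and T_bounded_linear: "lp_bounded_linear p T"
    and T_apply: "\<And>x. x \<in> lp p \<Longrightarrow> T x = translate c 1 x"

lemma translation_shift_exists:
  assumes "1 \<le> p" "weighted_bilateral_shift p w T"
  obtains c M where "translation_shift p T c M"
proof -
  interpret lp_exponent p
    using assms(1) by unfold_locales
  have w: "\<And>n. w n \<noteq> 0" "bounded (range w)"
    using assms(2) by (auto simp: weighted_bilateral_shift_def)
  obtain c where c: "\<And>n. c n \<noteq> 0" "\<And>n. c (n - 1) = w n * c n"
    using weight_potential_exists[of w] w(1) by blast
  obtain B where B: "\<And>n. norm (w n) \<le> B"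
    using w(2) by (auto simp: bounded_iff)
  have "translation_shift p T c (max 1 B)"
  proof
    show "norm (c (n - 1)) \<le> max 1 B * norm (c n)" for n
      using B[of n] by (auto simp: c(2) norm_mult intro!: mult_right_mono)
    show "T x = translate c 1 x" if "x \<in> lp p" for x
    proof -
      have "w (n + 1) = c n / c (n + 1)" for n
        using c(1)[of "n + 1"] c(2)[of "n + 1"] by simp
      then show ?thesis
        using weighted_bilateral_shift_apply[OF assms(2) that] by (simp add: translate_def)
    qed
  qed (use c assms(2) in \<open>auto simp: weighted_bilateral_shift_def\<close>)
  then show thesis
    by (rule that)
qed

context translation_shift
begin

lemma T_in_lp: "x \<in> lp p \<Longrightarrow> T x \<in> lp p"
  using T_bounded_linear by (simp add: lp_bounded_linear_def)

lemma funpow_in_lp: "x \<in> lp p \<Longrightarrow> (T ^^ n) x \<in> lp p"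
  by (induction n) (auto intro: T_in_lp)

lemma funpow_eq_translate: "x \<in> lp p \<Longrightarrow> (T ^^ n) x = translate c (int n) x"
proof (induction n)
  case (Suc n)
  then show ?case
    using T_apply[OF funpow_in_lp[OF Suc.prems, of n]] c_nonzero
    by (simp add: translate_translate)
qed (simp add: translate_0 c_nonzero)

lemma norm_c_le:
  assumes "i \<le> j"
  shows "norm (c i) \<le> M ^ nat (j - i) * norm (c j)"
  using assms
proof (induction j rule: int_ge_induct)
  case (step j)
  have "norm (c i) \<le> M ^ nat (j - i) * norm (c j)"
    by (rule step.IH)
  also have "\<dots> \<le> M ^ nat (j - i) * (M * norm (c (j + 1)))"
    using c_step[of "j + 1"] M_ge_1 by (intro mult_left_mono) auto
  also have "\<dots> = M ^ nat (j + 1 - i) * norm (c (j + 1))"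
  proof -
    have "nat (j + 1 - i) = Suc (nat (j - i))"
      using step.hyps by simp
    then show ?thesis
      by simp
  qed
  finally show ?case .
qed auto

lemma translate_in_c00:
  assumes "x \<in> c00"
  shows "translate c k x \<in> c00"
proof (rule c00I)
  show "finite ((\<lambda>n. n - k) ` {n. x n \<noteq> 0})"
    using assms by (simp add: c00_def)
  show "translate c k x n = 0" if "n \<notin> (\<lambda>n. n - k) ` {n. x n \<noteq> 0}" for n
    using that image_eqI[of n "\<lambda>n. n - k" "n + k" "{n. x n \<noteq> 0}"] by (auto simp: translate_def)
qed

text \<open>
  The support moves to indices at most \<open>m - k\<close>, and a step to the left enlarges \<open>\<bar>c\<bar>\<close> by the factor
  \<open>M\<close> at most. So \<open>\<bar>c (m - k)\<bar>\<close> controls all coordinates, with a constant independent of \<open>k\<close>.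
\<close>

lemma lp_norm_translate_le:
  assumes "x \<in> c00" "\<And>n. x n \<noteq> 0 \<Longrightarrow> n \<le> m"
  obtains C where "0 < C" "\<And>k. lp_norm p (translate c k x) \<le> C * norm (c (m - k))"
proof -
  define F where "F = {n. x n \<noteq> 0}"
  have F: "finite F"
    using assms by (simp add: F_def c00_def)
  define C where "C = (\<Sum>n\<in>F. norm (x n / c n) * M ^ nat (m - n))"
  have "lp_norm p (translate c k x) \<le> (C + 1) * norm (c (m - k))" for k
  proof -
    have "lp_norm p (translate c k x) \<le> (\<Sum>n\<in>(\<lambda>n. n - k) ` F. norm (translate c k x n))"
    proof (intro lp_norm_finite_support_le finite_imageI F)
      show "translate c k x n = 0" if "n \<notin> (\<lambda>n. n - k) ` F" for n
        using that image_eqI[of n "\<lambda>n. n - k" "n + k" F] by (auto simp: translate_def F_def)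
    qed
    also have "\<dots> = (\<Sum>n\<in>F. norm (x n / c n) * norm (c (n - k)))"
      by (subst sum.reindex) (auto simp: inj_on_def translate_def norm_mult norm_divide mult.commute)
    also have "\<dots> \<le> (\<Sum>n\<in>F. norm (x n / c n) * (M ^ nat (m - n) * norm (c (m - k))))"
    proof (intro sum_mono mult_left_mono)
      fix n
      assume "n \<in> F"
      then have "n - k \<le> m - k"
        using assms(2) by (simp add: F_def)
      from norm_c_le[OF this] show "norm (c (n - k)) \<le> M ^ nat (m - n) * norm (c (m - k))"
        by simp
    qed auto
    also have "\<dots> = C * norm (c (m - k))"
      by (simp add: C_def sum_distrib_right mult.assoc)
    also have "\<dots> \<le> (C + 1) * norm (c (m - k))"
      by (intro mult_right_mono) auto
    finally show ?thesis .
  qed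
  moreover have "0 < C + 1"
    using M_ge_1 by (auto simp: C_def intro!: sum_nonneg add_nonneg_pos)
  ultimately show thesis
    using that by blast
qed

lemma c00_upper_bound:
  assumes "x \<in> c00"
  obtains m where "\<And>n. x n \<noteq> 0 \<Longrightarrow> n \<le> m"
proof -
  have "bdd_above {n. x n \<noteq> 0}"
    using assms by (simp add: c00_def)
  then show thesis
    using that by (auto simp: bdd_above_def)
qed

section \<open>A sufficient condition for supercyclicity\<close>

text \<open>
  The perturbation of \<open>z\<close> by a multiple \<open>t\<close> of the backward translate of \<open>y\<close> has size \<open>t * \<bar>c (m + k)\<bar>\<close>,
  and dividing the \<open>k\<close>-th iterate of the perturbed vector by \<open>t\<close> returns \<open>y\<close> up to an error of size
  \<open>\<bar>c (m - k)\<bar> / t\<close>. Both can be made small as soon as the product \<open>\<bar>c (m - k)\<bar> * \<bar>c (m + k)\<bar>\<close> is.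
\<close>

lemma supercyclic_power:
  assumes small: "\<And>m e. 0 < e \<Longrightarrow>
    \<exists>n::nat. norm (c (m - int (N * n))) * norm (c (m + int (N * n))) < e"
  shows "supercyclic p (T ^^ N)"
proof -
  define \<F> where "\<F> = {(\<lambda>x. cscale a (((T ^^ N) ^^ n) x)) |a n. True}"
  have lin: "lp_bounded_linear p L" if "L \<in> \<F>" for L
    using that T_bounded_linear
    by (auto simp: \<F>_def intro!: lp_bounded_linear_compose[OF lp_bounded_linear_cscale]
        lp_bounded_linear_funpow)
  have step: "\<exists>x\<in>lp p. \<exists>L\<in>\<F>. lp_norm p (x - z) < e \<and> lp_norm p (L x - y) < e"
    if z: "z \<in> c00" and y: "y \<in> c00" and e: "0 < e" for z y e
  proof -
    obtain mz my where "\<And>n. z n \<noteq> 0 \<Longrightarrow> n \<le> mz" "\<And>n. y n \<noteq> 0 \<Longrightarrow> n \<le> my"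
      using c00_upper_bound z y by metis
    then have m: "\<And>n. z n \<noteq> 0 \<Longrightarrow> n \<le> max mz my" "\<And>n. y n \<noteq> 0 \<Longrightarrow> n \<le> max mz my"
      by (auto simp: le_max_iff_disj)
    define m where "m = max mz my"
    obtain Cz where Cz: "0 < Cz" "\<And>k. lp_norm p (translate c k z) \<le> Cz * norm (c (m - k))"
      using lp_norm_translate_le[OF z m(1)] m_def by blast
    obtain Cy where Cy: "0 < Cy" "\<And>k. lp_norm p (translate c k y) \<le> Cy * norm (c (m - k))"
      using lp_norm_translate_le[OF y m(2)] m_def by blast
    define C where "C = max Cz Cy"
    have "0 < C"
      using Cz by (simp add: C_def)
    then obtain n where n: "norm (c (m - int (N * n))) * norm (c (m + int (N * n))) < (e / C)\<^sup>2"
      using small[of "(e / C)\<^sup>2" m] e by auto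
    define k where "k = int (N * n)"
    define A where "A = norm (c (m - k))"
    define B where "B = norm (c (m + k))"
    have AB: "0 < A" "0 < B" "sqrt (A * B) < e / C"
      using n c_nonzero e \<open>0 < C\<close> by (auto simp: A_def B_def k_def intro!: real_less_lsqrt)
    \<comment> \<open>The scalar that balances the size \<open>t * B\<close> of the perturbation against the size \<open>A / t\<close>
       of the image of \<open>z\<close>.\<close>
    define t where "t = sqrt (A / B)"
    have t: "0 < t" "t * B = sqrt (A * B)" "A / t = sqrt (A * B)"
      using AB by (auto simp: t_def real_sqrt_divide real_sqrt_mult field_simps)
    define h where "h = cscale (of_real t) (translate c (- k) y)"
    have h_c00: "h \<in> c00"
      using translate_in_c00[OF y] unfolding h_def c00_def
      by (simp add: c00_def rev_finite_subset Collect_mono)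
    define x where "x = z + h"
    have x: "x \<in> lp p"
      unfolding x_def by (intro add_in_lp c00_in_lp z h_c00)
    have "x - z = h"
      by (simp add: x_def)
    moreover have "lp_norm p h < e"
    proof -
      have "lp_norm p h = t * lp_norm p (translate c (- k) y)"
        using t(1) by (simp add: h_def lp_norm_cscale c00_in_lp translate_in_c00 y)
      also have "\<dots> \<le> t * (C * B)"
      proof (intro mult_left_mono)
        have "lp_norm p (translate c (- k) y) \<le> Cy * B"
          using Cy(2)[of "- k"] by (simp add: B_def)
        also have "\<dots> \<le> C * B"
          using AB by (intro mult_right_mono) (auto simp: C_def)
        finally show "lp_norm p (translate c (- k) y) \<le> C * B" .
      qed (use t in simp)
      also have "\<dots> = C * sqrt (A * B)"
        using t(2) by (simp add: mult.left_commute)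
      also have "\<dots> < e"
        using AB(3) \<open>0 < C\<close> by (simp add: field_simps)
      finally show ?thesis .
    qed
    moreover define L where "L = (\<lambda>x. cscale (of_real (1 / t)) (((T ^^ N) ^^ n) x))"
    have "L \<in> \<F>"
      by (auto simp: L_def \<F>_def)
    moreover have "L x = cscale (of_real (1 / t)) (translate c k z) + y"
    proof -
      have "((T ^^ N) ^^ n) x = translate c k x"
        using funpow_eq_translate[OF x, of "N * n"] by (simp add: funpow_mult k_def mult.commute)
      also have "\<dots> = translate c k z + cscale (of_real t) y"
        by (simp add: x_def h_def translate_add translate_cscale translate_translate translate_0
            c_nonzero)
      finally show ?thesis
        using t(1) by (simp add: L_def cfun.scale_right_distrib)
    qed
    then have "L x - y = cscale (of_real (1 / t)) (translate c k z)"
      by simp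
    moreover have "lp_norm p (cscale (of_real (1 / t)) (translate c k z)) < e"
    proof -
      have "lp_norm p (cscale (of_real (1 / t)) (translate c k z)) = lp_norm p (translate c k z) / t"
        using t(1) by (simp add: lp_norm_cscale c00_in_lp translate_in_c00 z norm_divide)
      also have "\<dots> \<le> (C * A) / t"
      proof (intro divide_right_mono)
        have "lp_norm p (translate c k z) \<le> Cz * A"
          using Cz(2)[of k] by (simp add: A_def)
        also have "\<dots> \<le> C * A"
          using AB by (intro mult_right_mono) (auto simp: C_def)
        finally show "lp_norm p (translate c k z) \<le> C * A" .
      qed (use t in simp)
      also have "\<dots> = C * sqrt (A * B)"
        using t(3) by (metis times_divide_eq_right)
      also have "\<dots> < e"
        using AB(3) \<open>0 < C\<close> by (simp add: field_simps)
      finally show ?thesis .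
    qed
    ultimately show ?thesis
      using x by metis
  qed
  obtain x where "x \<in> lp p" "lp_dense p {L x |L. L \<in> \<F>}"
    using universal_vector_exists[of \<F>] lin step by blast
  moreover have "{L x |L. L \<in> \<F>} = {cscale a (((T ^^ N) ^^ n) x) |a n. True}"
  proof (intro equalityI subsetI)
    fix s
    assume "s \<in> {cscale a (((T ^^ N) ^^ n) x) |a n. True}"
    then obtain a n where s: "s = cscale a (((T ^^ N) ^^ n) x)"
      by blast
    have "(\<lambda>u. cscale a (((T ^^ N) ^^ n) u)) \<in> \<F>"
      unfolding \<F>_def by blast
    then show "s \<in> {L x |L. L \<in> \<F>}"
      unfolding s mem_Collect_eq
      by (intro exI[of _ "\<lambda>u. cscale a (((T ^^ N) ^^ n) u)"] conjI refl)
  qed (auto simp: \<F>_def)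
  ultimately show ?thesis
    by (auto simp: supercyclic_def)
qed

end

section \<open>A necessary condition for supercyclicity\<close>

context translation_shift
begin

text \<open>
  If \<open>a\<close> times the \<open>n\<close>-th iterate of \<open>x\<close> is near the basis vector at \<open>m\<close>, then its coordinate at \<open>m\<close>
  forces \<open>\<bar>a\<bar>\<close> to be at least of order \<open>\<bar>c (m + n)\<bar>\<close>, whereas the coordinate to which a fixed nonzero
  coordinate of \<open>x\<close> has moved is nearly 0 and forces \<open>\<bar>a\<bar> * \<bar>c (m - n)\<bar>\<close> to be small.
\<close>

lemma supercyclic_imp_small_products:
  assumes "supercyclic p T" "0 < e"
  shows "\<exists>n::nat. norm (c (m - int n)) * norm (c (m + int n)) < e"
proof -
  obtain x where x: "x \<in> lp p" and "lp_dense p {cscale a ((T ^^ n) x) |a n. True}"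
    using assms(1) by (auto simp: supercyclic_def)
  then have dense: "\<exists>s\<in>{cscale a ((T ^^ n) x) |a n. True}. lp_norm p (y - s) < d"
    if "y \<in> lp p" "0 < d" for y d
    using that unfolding lp_dense_def by blast
  have approx: "\<exists>a n. lp_norm p (y - cscale a (translate c (int n) x)) < d"
    if "y \<in> lp p" "0 < d" for y d
    using dense[OF that] unfolding funpow_eq_translate[OF x] by blast
  have coord: "norm (y i - a * (c i / c (i + int n) * x (i + int n))) < d"
    if "y \<in> lp p" "lp_norm p (y - cscale a (translate c (int n) x)) < d" for y a n d i
  proof -
    have "translate c (int n) x \<in> lp p"
      using funpow_in_lp[OF x, of n] by (simp add: funpow_eq_translate[OF x])
    then have "y - cscale a (translate c (int n) x) \<in> lp p"
      by (intro diff_in_lp cscale_in_lp that)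
    from norm_coord_le_lp_norm[OF this, of i] that(2) show ?thesis
      by (simp add: translate_def)
  qed
  \<comment> \<open>A supercyclic vector has two adjacent nonzero coordinates at or above \<open>m\<close>, since some
     multiple of a translate of it resembles \<open>1, 1\<close> at the positions \<open>m, m + 1\<close>.\<close>
  obtain j where j: "m \<le> j" "x j \<noteq> 0" "x (j + 1) \<noteq> 0"
  proof -
    define y where "y = basis_vec m + basis_vec (m + 1)"
    have y: "y \<in> lp p" "y m = 1" "y (m + 1) = 1"
      unfolding y_def using add_in_lp[OF basis_vec_in_lp basis_vec_in_lp]
      by (auto simp: basis_vec_def)
    obtain a n where "lp_norm p (y - cscale a (translate c (int n) x)) < 1"
      using approx[OF y(1), of 1] by auto
    note near = coord[OF y(1) this]
    have "x (m + int n) \<noteq> 0" "x (m + 1 + int n) \<noteq> 0"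
      using near[of m] near[of "m + 1"] y by auto
    then show thesis
      by (intro that[of "m + int n"]) (auto simp: ac_simps)
  qed
  define q where "q = min (norm (x j / c j)) (norm (x (j + 1) / c (j + 1)))"
  define K where "K = M ^ nat (j + 1 - m)"
  define R where "R = lp_norm p x"
  have q: "0 < q"
    using j c_nonzero by (simp add: q_def)
  have K: "0 < K"
    using M_ge_1 by (simp add: K_def)
  have R: "0 < R"
    using norm_coord_le_lp_norm[OF x, of j] j(2) unfolding R_def
    by (meson less_le_trans zero_less_norm_iff)
  define Q where "Q = 2 * K * norm (c m) * R / q"
  have Q: "0 < Q"
    using q K R c_nonzero by (simp add: Q_def)
  define d where "d = min (1 / 2) (e / (2 * Q))"
  have d: "0 < d" "d \<le> 1 / 2" "Q * d < e"
  proof -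
    show "0 < d" "d \<le> 1 / 2"
      using Q assms(2) by (auto simp: d_def)
    have "Q * d \<le> Q * (e / (2 * Q))"
      using Q by (intro mult_left_mono) (auto simp: d_def)
    also have "\<dots> < e"
      using Q assms(2) by simp
    finally show "Q * d < e" .
  qed
  obtain a n where "lp_norm p (basis_vec m - cscale a (translate c (int n) x)) < d"
    using approx[OF basis_vec_in_lp d(1)] by blast
  note near = coord[OF basis_vec_in_lp this]
  have a_large: "norm (c (m + int n)) \<le> 2 * norm a * norm (c m) * R"
  proof -
    have "norm (1 - a * (c m / c (m + int n) * x (m + int n))) < 1 / 2"
      using near[of m] d(2) by (simp add: basis_vec_def)
    then have "1 / 2 \<le> norm (a * (c m / c (m + int n) * x (m + int n)))"
      using norm_triangle_ineq2[of 1 "1 - a * (c m / c (m + int n) * x (m + int n))"]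
        norm_triangle_ineq[of "1 - a * (c m / c (m + int n) * x (m + int n))"
          "a * (c m / c (m + int n) * x (m + int n))"]
      by simp
    then have "norm (c (m + int n)) \<le> 2 * norm a * norm (c m) * norm (x (m + int n))"
      using c_nonzero[of "m + int n"] by (simp add: norm_mult norm_divide field_simps)
    also have "\<dots> \<le> 2 * norm a * norm (c m) * R"
      unfolding R_def by (intro mult_left_mono norm_coord_le_lp_norm x) auto
    finally show ?thesis .
  qed
  \<comment> \<open>After the translation by \<open>n\<close>, at least one of the two nonzero coordinates does not land at
     position \<open>m\<close>, so it must be small.\<close>
  obtain i where i: "i = j \<or> i = j + 1" "i - int n \<noteq> m"
    by (metis add_cancel_left_right diff_add_cancel zero_neq_one)
  have a_small: "norm a * norm (c (i - int n)) \<le> d / q"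
  proof -
    have "norm (a * (c (i - int n) / c i * x i)) < d"
      using near[of "i - int n"] i(2) by (simp add: basis_vec_def)
    then have "norm a * norm (c (i - int n)) * norm (x i / c i) \<le> d"
      by (simp add: norm_mult norm_divide field_simps)
    moreover have "norm a * norm (c (i - int n)) * q \<le> norm a * norm (c (i - int n)) * norm (x i / c i)"
      using i(1) by (intro mult_left_mono) (auto simp: q_def)
    ultimately show ?thesis
      using q by (simp add: pos_le_divide_eq)
  qed
  have "norm (c (m - int n)) \<le> M ^ nat (i - m) * norm (c (i - int n))"
    using norm_c_le[of "m - int n" "i - int n"] i(1) j(1) by auto
  also have "\<dots> \<le> K * norm (c (i - int n))"
    unfolding K_def using i(1) M_ge_1 by (intro mult_right_mono power_increasing) auto
  finally have "norm (c (m - int n)) * norm (c (m + int n)) \<le>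
      (K * norm (c (i - int n))) * (2 * norm a * norm (c m) * R)"
    using a_large by (intro mult_mono) (use K in auto)
  also have "\<dots> = (2 * K * norm (c m) * R) * (norm a * norm (c (i - int n)))"
    by (simp add: algebra_simps)
  also have "\<dots> \<le> (2 * K * norm (c m) * R) * (d / q)"
    using a_small K R by (intro mult_left_mono) auto
  also have "\<dots> = Q * d"
    by (simp add: Q_def)
  also have "\<dots> < e"
    by (rule d)
  finally show ?thesis
    by blast
qed

end

section \<open>Cyclic squares for exponents at most 2\<close>

context lp_exponent
begin

lemma
  assumes "p \<le> 2" and u: "u \<in> lp p" and v: "v \<in> lp p"
  shows pairing_summable: "(\<lambda>n. norm (u n * v n)) summable_on UNIV"
    and norm_pairing_le: "norm (\<Sum>\<^sub>\<infinity>n. u n * v n) \<le> lp_norm p u * lp_norm p v"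
proof -
  define A where "A = lp_norm p u"
  define B where "B = lp_norm p v"
  have finite_le: "(\<Sum>n\<in>F. norm (u n * v n)) \<le> A * B" if F: "finite F" for F
  proof (cases "A = 0 \<or> B = 0")
    case True
    then have "u = 0 \<or> v = 0"
      using lp_norm_eq_0_iff u v by (auto simp: A_def B_def)
    then show ?thesis
      using True by auto
  next
    case False
    then have pos: "0 < A" "0 < B"
      using lp_norm_nonneg[of p u] lp_norm_nonneg[of p v] by (auto simp: A_def B_def less_le)
    have sq: "t\<^sup>2 \<le> t powr p" if "0 \<le> t" "t \<le> 1" for t :: real
      using that assms(1) powr_mono'[of p 2 t] by (cases "t = 0") auto
    \<comment> \<open>The coordinates of the unit vectors \<open>u / A\<close> and \<open>v / B\<close> are at most 1, so their squares
       are bounded by their \<open>p\<close>-th powers; this is where \<open>p \<le> 2\<close> enters.\<close>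
    have pointwise: "norm (u n * v n) \<le>
        A * B * ((norm (u n) powr p / A powr p + norm (v n) powr p / B powr p) / 2)" for n
    proof -
      define s where "s = norm (u n) / A"
      define t where "t = norm (v n) / B"
      have st: "0 \<le> s" "s \<le> 1" "0 \<le> t" "t \<le> 1"
        using pos norm_coord_le_lp_norm[OF u, of n] norm_coord_le_lp_norm[OF v, of n]
        by (auto simp: s_def t_def A_def B_def)
      have "s * t \<le> (s\<^sup>2 + t\<^sup>2) / 2"
        using sum_squares_bound[of s t] by simp
      also have "\<dots> \<le> (s powr p + t powr p) / 2"
        using sq[of s] sq[of t] st by simp
      finally have "A * B * (s * t) \<le> A * B * ((s powr p + t powr p) / 2)"
        using pos by (intro mult_left_mono) auto
      moreover have "A * B * (s * t) = norm (u n * v n)"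
        using pos by (simp add: s_def t_def norm_mult)
      ultimately show ?thesis
        using pos by (simp add: s_def t_def powr_divide)
    qed
    have "(\<Sum>n\<in>F. norm (u n * v n)) \<le>
        (\<Sum>n\<in>F. A * B * ((norm (u n) powr p / A powr p + norm (v n) powr p / B powr p) / 2))"
      by (intro sum_mono pointwise)
    also have "\<dots> = A * B * (((\<Sum>n\<in>F. norm (u n) powr p) / A powr p
        + (\<Sum>n\<in>F. norm (v n) powr p) / B powr p) / 2)"
      by (simp only: sum.distrib flip: sum_distrib_left sum_divide_distrib)
    also have "\<dots> \<le> A * B * ((1 + 1) / 2)"
      using pos finite_sum_le_lp_norm_powr[OF u F] finite_sum_le_lp_norm_powr[OF v F]
      by (intro mult_left_mono divide_right_mono add_mono) (auto simp: A_def B_def divide_le_eq_1)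
    finally show ?thesis
      by simp
  qed
  show sum: "(\<lambda>n. norm (u n * v n)) summable_on UNIV"
    by (intro nonneg_bdd_above_summable_on) (auto intro!: bdd_aboveI2 finite_le)
  have "norm (\<Sum>\<^sub>\<infinity>n. u n * v n) \<le> (\<Sum>\<^sub>\<infinity>n. norm (u n * v n))"
    by (rule norm_infsum_bound[OF sum])
  also have "\<dots> \<le> A * B"
    by (intro infsum_le_finite_sums sum finite_le)
  finally show "norm (\<Sum>\<^sub>\<infinity>n. u n * v n) \<le> lp_norm p u * lp_norm p v"
    by (simp add: A_def B_def)
qed

lemma not_dense_span_if_annihilated:
  assumes "p \<le> 2" and g: "g \<in> lp p" "g \<noteq> 0"
    and S: "S \<subseteq> lp p" "\<And>s. s \<in> S \<Longrightarrow> (\<Sum>\<^sub>\<infinity>n. g n * s n) = 0"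
  shows "\<not> lp_dense p (cfun.span S)"
proof
  assume dense: "lp_dense p (cfun.span S)"
  define \<phi> where "\<phi> = (\<lambda>z. \<Sum>\<^sub>\<infinity>n. g n * z n)"
  have sum: "(\<lambda>n. g n * z n) summable_on UNIV" if "z \<in> lp p" for z
    using pairing_summable[OF assms(1) g(1) that] by (rule abs_summable_summable)
  have add: "\<phi> (y + z) = \<phi> y + \<phi> z" if "y \<in> lp p" "z \<in> lp p" for y z
    using infsum_add[OF sum sum, OF that] by (simp add: \<phi>_def distrib_left)
  have scale: "\<phi> (cscale a z) = a * \<phi> z" for a z
    by (simp add: \<phi>_def mult.left_commute[of _ a] infsum_cmult_right')
  have "cfun.subspace {z \<in> lp p. \<phi> z = 0}"
  proof (rule cfun.subspaceI)
    show "0 \<in> {z \<in> lp p. \<phi> z = 0}"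
      by (simp add: \<phi>_def)
    show "y + z \<in> {z \<in> lp p. \<phi> z = 0}" if "y \<in> {z \<in> lp p. \<phi> z = 0}" "z \<in> {z \<in> lp p. \<phi> z = 0}" for y z
      using that add[of y z] add_in_lp[of y z] by simp
    show "cscale a z \<in> {z \<in> lp p. \<phi> z = 0}" if "z \<in> {z \<in> lp p. \<phi> z = 0}" for a z
      using that scale[of a z] cscale_in_lp[of z a] by simp
  qed
  then have kernel: "cfun.span S \<subseteq> {z \<in> lp p. \<phi> z = 0}"
    using S by (intro cfun.span_minimal) (auto simp: \<phi>_def)
  obtain k where k: "g k \<noteq> 0"
    using g(2) by (auto simp: fun_eq_iff)
  have "\<phi> (basis_vec k) = infsum (\<lambda>n. g n * basis_vec k n) {k}"
    unfolding \<phi>_def by (intro infsum_cong_neutral) (auto simp: basis_vec_def)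
  then have \<phi>_basis: "\<phi> (basis_vec k) = g k"
    by (simp add: basis_vec_def)
  define d where "d = norm (g k) / (lp_norm p g + 1)"
  have G: "0 < lp_norm p g + 1"
    using lp_norm_nonneg[of p g] by linarith
  then have "0 < d"
    using k by (simp add: d_def)
  then obtain s where s: "s \<in> cfun.span S" "lp_norm p (basis_vec k - s) < d"
    using dense basis_vec_in_lp unfolding lp_dense_def by blast
  define r where "r = basis_vec k - s"
  have sr: "s \<in> lp p" "\<phi> s = 0" "r \<in> lp p"
    using s(1) kernel diff_in_lp[OF basis_vec_in_lp] unfolding r_def by auto
  have "s + r = basis_vec k"
    by (simp add: r_def)
  with add[OF sr(1) sr(3)] have "\<phi> (basis_vec k) = \<phi> s + \<phi> r"
    by (simp only:)
  then have "g k = \<phi> r"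
    using sr(2) \<phi>_basis by simp
  then have "norm (g k) \<le> lp_norm p g * lp_norm p r"
    using norm_pairing_le[OF assms(1) g(1) sr(3)] by (simp add: \<phi>_def)
  also have "\<dots> \<le> (lp_norm p g + 1) * lp_norm p r"
    by (intro mult_right_mono) auto
  also have "\<dots> < (lp_norm p g + 1) * d"
    using s(2) G unfolding r_def by (intro mult_strict_left_mono)
  also have "\<dots> = norm (g k)"
    using G by (simp add: d_def)
  finally show False
    by simp
qed

lemma lp_reflect:
  assumes "x \<in> lp p"
  shows "(\<lambda>n. x (s - n)) \<in> lp p"
proof -
  have "bij (\<lambda>n. s - n)"
    by (rule bijI') (auto intro: exI[of _ "s - _"])
  from summable_on_reindex_bij_betw[OF this, of "\<lambda>n. norm (x n) powr p"] assms show ?thesis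
    by (simp add: lp_def)
qed

lemma lp_comparison:
  assumes "x \<in> lp p" "\<And>n. norm (y n) \<le> D * norm (x n)"
  shows "y \<in> lp p"
proof -
  have x': "cscale (of_real D) x \<in> lp p"
    by (rule cscale_in_lp[OF assms(1)])
  have "norm (y n) powr p \<le> norm (cscale (of_real D) x n) powr p" for n
  proof (rule powr_mono2)
    have "norm (y n) \<le> D * norm (x n)"
      by (rule assms)
    also have "\<dots> \<le> \<bar>D\<bar> * norm (x n)"
      by (intro mult_right_mono) auto
    finally show "norm (y n) \<le> norm (cscale (of_real D) x n)"
      by (simp add: norm_mult)
  qed (use p_ge_1 in auto)
  with x' show ?thesis
    unfolding lp_def mem_Collect_eq by (rule summable_on_comparison_test) auto
qed

end

context translation_shift
begin

text \<open>
  If the products stay away from 0, every orbit of \<open>T\<^sup>2\<close> is annihilated by a nonzero bounded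
  functional: the alternating pairing of \<open>x\<close> with its own reflection \<open>n \<mapsto> s - n\<close>. Here \<open>s\<close> must be
  odd for the signs to cancel; the lower bound, given for \<open>2 * m\<close>, passes to
  \<open>s = 2 * m + 1\<close> by the growth bound for \<open>c\<close>.
\<close>

lemma cyclic_square_imp_small_products:
  assumes "p \<le> 2" and cyc: "cyclic p (T ^^ 2)" and "0 < e"
  shows "\<exists>n::nat. norm (c (m - int n)) * norm (c (m + int n)) < e"
proof (rule ccontr)
  assume "\<not> ?thesis"
  then have large: "e \<le> norm (c (m - int n)) * norm (c (m + int n))" for n
    by (auto simp: not_less)
  obtain x where x: "x \<in> lp p" and dense: "lp_dense p (cfun.span {((T ^^ 2) ^^ n) x |n. True})"
    using cyc by (auto simp: cyclic_def)
  have orbit: "((T ^^ 2) ^^ n) x = translate c (int (2 * n)) x" for n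
    using funpow_eq_translate[OF x, of "2 * n"] by (simp only: funpow_mult mult.commute)
  have orbit_in: "{((T ^^ 2) ^^ n) x |n. True} \<subseteq> lp p"
    using funpow_in_lp[OF x] by (auto simp: funpow_mult)
  have "x \<noteq> 0"
  proof
    assume "x = 0"
    then have zero: "((T ^^ 2) ^^ n) x i = 0" for n i
      unfolding orbit by (simp add: translate_def)
    have "\<not> lp_dense p (cfun.span {((T ^^ 2) ^^ n) x |n. True})"
    proof (rule not_dense_span_if_annihilated[OF assms(1) basis_vec_in_lp[of 0]])
      show "basis_vec 0 \<noteq> 0"
        by (auto simp: basis_vec_def fun_eq_iff)
      show "(\<Sum>\<^sub>\<infinity>n. basis_vec 0 n * s n) = 0" if "s \<in> {((T ^^ 2) ^^ n) x |n. True}" for s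
        using that zero by auto
    qed (rule orbit_in)
    with dense show False
      by blast
  qed
  define s where "s = 2 * m + 1"
  define v where "v = (\<lambda>n. x n / c n)"
  define \<sigma> where "\<sigma> = (\<lambda>n::int. if even n then 1 else - 1 :: complex)"
  define g where "g = (\<lambda>n. \<sigma> n * v (s - n) / c n)"
  have "norm (g n) \<le> M / e * norm (x (s - n))" for n
  proof -
    have "e \<le> norm (c n) * norm (c (2 * m - n))"
      using large[of "nat \<bar>n - m\<bar>"] by (cases "m \<le> n") (simp_all add: mult.commute)
    also have "\<dots> \<le> norm (c n) * (M * norm (c (s - n)))"
      using c_step[of "s - n"] by (intro mult_left_mono) (auto simp: s_def algebra_simps)
    finally have "e / M \<le> norm (c n) * norm (c (s - n))"
      using M_ge_1 by (simp add: field_simps)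
    then have "1 / (norm (c n) * norm (c (s - n))) \<le> 1 / (e / M)"
      using M_ge_1 \<open>0 < e\<close> by (intro divide_left_mono mult_pos_pos) (auto simp: c_nonzero)
    then have "1 / (norm (c n) * norm (c (s - n))) * norm (x (s - n)) \<le> M / e * norm (x (s - n))"
      by (intro mult_right_mono) auto
    moreover have "norm (g n) = 1 / (norm (c n) * norm (c (s - n))) * norm (x (s - n))"
      by (simp add: g_def v_def \<sigma>_def norm_mult norm_divide)
    ultimately show ?thesis
      by simp
  qed
  then have g: "g \<in> lp p"
    by (rule lp_comparison[OF lp_reflect[OF x]])
  have "g \<noteq> 0"
  proof -
    obtain i where "x i \<noteq> 0"
      using \<open>x \<noteq> 0\<close> by (auto simp: fun_eq_iff)
    then have "g (s - i) \<noteq> 0"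
      by (simp add: g_def v_def \<sigma>_def c_nonzero)
    then show ?thesis
      by (metis zero_fun_apply)
  qed
  have "(\<Sum>\<^sub>\<infinity>n. g n * translate c (2 * k) x n) = 0" for k
  proof -
    define f where "f = (\<lambda>n. g n * translate c (2 * k) x n)"
    have f: "f n = \<sigma> n * v (s - n) * v (n + 2 * k)" for n
      by (simp add: f_def g_def v_def translate_def c_nonzero)
    \<comment> \<open>The reflection \<open>n \<mapsto> s - 2 * k - n\<close> exchanges the two factors and, \<open>s\<close> being odd,
       changes the sign.\<close>
    have antisym: "f (s - 2 * k - n) = - f n" for n
      by (simp add: f \<sigma>_def s_def algebra_simps)
    have "bij (\<lambda>n. s - 2 * k - n)"
      by (rule bijI') (auto intro: exI[of _ "s - 2 * k - _"])
    then have "infsum f UNIV = (\<Sum>\<^sub>\<infinity>n. f (s - 2 * k - n))"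
      by (rule infsum_reindex_bij_betw[symmetric])
    also have "\<dots> = - infsum f UNIV"
      unfolding antisym by (rule infsum_uminus)
    finally show ?thesis
      by (simp add: f_def)
  qed
  then have "(\<Sum>\<^sub>\<infinity>n. g n * s n) = 0" if "s \<in> {((T ^^ 2) ^^ n) x |n. True}" for s
    using that unfolding orbit by auto
  with dense not_dense_span_if_annihilated[OF assms(1) g \<open>g \<noteq> 0\<close> orbit_in] show False
    by blast
qed

end

section \<open>The unweighted shift for exponents above 2\<close>

text \<open>
  This keeps the off-diagonal terms \<open>i \<noteq> j\<close> of a double sum of translates by \<open>Q * (2 ^ i - 2 ^ j)\<close>
  apart.
\<close>

lemma pow2_diff_inject:
  assumes "(2::int) ^ i - 2 ^ j = 2 ^ k - 2 ^ l" "i \<noteq> j" "k \<noteq> l"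
  shows "i = k \<and> j = l"
proof -
  \<comment> \<open>A positive difference \<open>2 ^ i - 2 ^ j\<close> lies in the half-open interval
     \<open>{2 ^ (i - 1)..<2 ^ i}\<close>, and these intervals are disjoint for different \<open>i\<close>.\<close>
  have not_less: "\<not> i < k" if "(2::int) ^ i - 2 ^ j = 2 ^ k - 2 ^ l" "l < k" for i j k l :: nat
  proof
    assume "i < k"
    then have "(2::int) ^ i \<le> 2 ^ (k - 1)" "(2::int) ^ l \<le> 2 ^ (k - 1)"
      using that(2) by (auto intro!: power_increasing)
    moreover have "(2::int) ^ k = 2 * 2 ^ (k - 1)"
      using that(2) by (cases k) auto
    moreover have "(0::int) < 2 ^ j"
      by simp
    ultimately show False
      using that(1) by linarith
  qed
  have top_eq: "i = k" if "(2::int) ^ i - 2 ^ j = 2 ^ k - 2 ^ l" "j < i" "l < k" for i j k l :: nat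
    using not_less[of i j k l] not_less[of k l i j] that by force
  have order: "j < i \<longleftrightarrow> (2::int) ^ j < 2 ^ i" for i j :: nat
    by simp
  show ?thesis
  proof (cases "j < i")
    case True
    then have "l < k"
      using assms(1) order[of j i] order[of l k] by linarith
    then have "i = k"
      using top_eq assms(1) True by blast
    with assms(1) show ?thesis
      by simp
  next
    case False
    then have "i < j"
      using assms(2) by simp
    moreover have "k < l"
      using assms(1) order[of i j] order[of k l] \<open>i < j\<close> by linarith
    moreover have "(2::int) ^ j - 2 ^ i = 2 ^ l - 2 ^ k"
      using assms(1) by linarith
    ultimately have "j = l"
      using top_eq by blast
    with assms(1) show ?thesis
      by simp
  qed
qed

abbreviation unit_translate :: "int \<Rightarrow> (int \<Rightarrow> complex) \<Rightarrow> int \<Rightarrow> complex" where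
  "unit_translate \<equiv> translate (\<lambda>_. 1)"

lemma unit_translate_apply: "unit_translate k x n = x (n + k)"
  by (simp add: translate_def)

context lp_exponent
begin

text \<open>
  Translates by distinct multiples of \<open>Q > 2 * R\<close> have disjoint supports, so the \<open>p\<close>-th powers of the
  norms add up. This gives the exponent \<open>1 / p\<close> in place of the 1 of the triangle inequality.
\<close>

lemma lp_norm_sum_disjoint_translates:
  assumes "finite I" "inj_on f I" and x: "x \<in> lp p" "\<And>n. x n \<noteq> 0 \<Longrightarrow> \<bar>n\<bar> \<le> R" and "2 * R < Q"
  shows "lp_norm p (\<Sum>i\<in>I. unit_translate (Q * f i) x) \<le> real (card I) powr (1 / p) * lp_norm p x"
proof (rule lp_norm_leI)
  fix F :: "int set"
  assume F: "finite F"
  have pointwise: "norm ((\<Sum>i\<in>I. unit_translate (Q * f i) x) n) powr p \<le>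
      (\<Sum>i\<in>I. norm (x (n + Q * f i)) powr p)" for n
  proof (cases "\<exists>i\<in>I. x (n + Q * f i) \<noteq> 0")
    case True
    then obtain i where i: "i \<in> I" "x (n + Q * f i) \<noteq> 0"
      by blast
    have "x (n + Q * f k) = 0" if k: "k \<in> I" "k \<noteq> i" for k
    proof (rule ccontr)
      assume "x (n + Q * f k) \<noteq> 0"
      then have bounds: "\<bar>n + Q * f k\<bar> \<le> R" "\<bar>n + Q * f i\<bar> \<le> R"
        using x(2) i(2) by auto
      have "f k \<noteq> f i"
        using assms(2) k i(1) by (auto dest: inj_onD)
      then have "1 \<le> \<bar>f k - f i\<bar>"
        by linarith
      moreover have "0 \<le> Q"
        using bounds assms(5) by linarith
      ultimately have "Q * 1 \<le> Q * \<bar>f k - f i\<bar>"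
        by (intro mult_left_mono)
      also have "\<dots> = \<bar>(n + Q * f k) - (n + Q * f i)\<bar>"
      proof -
        have "(n + Q * f k) - (n + Q * f i) = Q * (f k - f i)"
          by (simp add: right_diff_distrib)
        then show ?thesis
          using \<open>0 \<le> Q\<close> by (simp add: abs_mult)
      qed
      finally show False
        using bounds assms(5) by linarith
    qed
    then have "(\<Sum>k\<in>I. x (n + Q * f k)) = (\<Sum>k\<in>{i}. x (n + Q * f k))"
      using assms(1) i(1) by (intro sum.mono_neutral_right) auto
    then have "(\<Sum>k\<in>I. x (n + Q * f k)) = x (n + Q * f i)"
      by simp
    moreover have "norm (x (n + Q * f i)) powr p \<le> (\<Sum>i\<in>I. norm (x (n + Q * f i)) powr p)"
      using assms(1) i(1) by (intro member_le_sum) auto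
    ultimately show ?thesis
      by (simp add: sum_fun_apply unit_translate_apply)
  next
    case False
    then show ?thesis
      by (simp add: sum_fun_apply unit_translate_apply sum_nonneg)
  qed
  have "(\<Sum>n\<in>F. norm ((\<Sum>i\<in>I. unit_translate (Q * f i) x) n) powr p) \<le>
      (\<Sum>n\<in>F. \<Sum>i\<in>I. norm (x (n + Q * f i)) powr p)"
    by (intro sum_mono pointwise)
  also have "\<dots> = (\<Sum>i\<in>I. \<Sum>n\<in>F. norm (x (n + Q * f i)) powr p)"
    by (rule sum.swap)
  also have "\<dots> \<le> (\<Sum>i\<in>I. lp_norm p x powr p)"
  proof (rule sum_mono)
    fix i
    have "(\<Sum>n\<in>F. norm (x (n + Q * f i)) powr p) = (\<Sum>n\<in>(\<lambda>n. n + Q * f i) ` F. norm (x n) powr p)"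
      by (subst sum.reindex) (auto simp: inj_on_def)
    also have "\<dots> \<le> lp_norm p x powr p"
      by (intro finite_sum_le_lp_norm_powr x finite_imageI F)
    finally show "(\<Sum>n\<in>F. norm (x (n + Q * f i)) powr p) \<le> lp_norm p x powr p" .
  qed
  also have "\<dots> = (real (card I) powr (1 / p) * lp_norm p x) powr p"
    using p_ge_1 by (simp add: powr_mult powr_powr)
  finally show "(\<Sum>n\<in>F. norm ((\<Sum>i\<in>I. unit_translate (Q * f i) x) n) powr p) \<le>
      (real (card I) powr (1 / p) * lp_norm p x) powr p" .
qed auto

lemma lp_dense_mono:
  assumes "lp_dense p S" "S \<subseteq> S'" "S' \<subseteq> lp p"
  shows "lp_dense p S'"
  using assms unfolding lp_dense_def by blast

lemma span_subset_lp: "S \<subseteq> lp p \<Longrightarrow> cfun.span S \<subseteq> lp p"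
  by (rule cfun.span_minimal[OF _ subspace_lp])

lemma lp_bounded_linear_sum:
  fixes K :: nat
  assumes "\<And>i. lp_bounded_linear p (L i)"
  shows "lp_bounded_linear p (\<lambda>x. \<Sum>i<K. L i x)"
proof (induction K)
  case 0
  have "lp_bounded_linear p (\<lambda>x. 0)"
    unfolding lp_bounded_linear_def by (auto intro: exI[of _ 0])
  then show ?case
    by (simp only: lessThan_0 sum.empty)
next
  case (Suc K)
  from lp_bounded_linear_add[OF Suc.IH assms[of K]] show ?case
    by (simp only: sum.lessThan_Suc)
qed

end

context translation_shift
begin

lemma orbit_subset_lp:
  assumes "x \<in> lp p"
  shows "{((T ^^ N) ^^ n) x |n. True} \<subseteq> lp p"
  using funpow_in_lp[OF assms] by (auto simp: funpow_mult)

lemma supercyclic_imp_cyclic: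
  assumes "supercyclic p (T ^^ N)"
  shows "cyclic p (T ^^ N)"
proof -
  obtain x where x: "x \<in> lp p" and dense: "lp_dense p {cscale a (((T ^^ N) ^^ n) x) |a n. True}"
    using assms by (auto simp: supercyclic_def)
  have "lp_dense p (cfun.span {((T ^^ N) ^^ n) x |n. True})"
  proof (rule lp_dense_mono[OF dense])
    show "{cscale a (((T ^^ N) ^^ n) x) |a n. True} \<subseteq> cfun.span {((T ^^ N) ^^ n) x |n. True}"
      by (auto intro!: cfun.span_scale[OF cfun.span_base])
  qed (intro span_subset_lp orbit_subset_lp x)
  with x show ?thesis
    by (auto simp: cyclic_def)
qed

end

text \<open>
  Polynomials in \<open>T ^^ N\<close> with \<open>K\<close> equal coefficients \<open>a = K powr (- 1 / 2)\<close> are enough. The same \<open>a\<close>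
  scales the perturbation of \<open>z\<close>, so that the \<open>K\<close> diagonal terms carry the total coefficient 1,
  whereas a sum of \<open>K\<close> disjoint translates with coefficient \<open>a\<close> has norm of order
  \<open>\<delta> K = K powr (1 / p - 1 / 2)\<close>, and the off-diagonal terms have norm of order \<open>(\<delta> K)\<^sup>2\<close>.
\<close>

lemma unweighted_shift_power_cyclic:
  assumes "2 < p" and T: "translation_shift p T (\<lambda>_. 1) 1" and N: "1 \<le> N"
  shows "cyclic p (T ^^ N)"
proof -
  interpret translation_shift p T "\<lambda>_. 1" 1
    by (rule T)
  define \<F> where "\<F> = (\<lambda>(a, K, m). (\<lambda>x. \<Sum>i<K. cscale a (((T ^^ N) ^^ m i) x))) `
    (UNIV :: (complex \<times> nat \<times> (nat \<Rightarrow> nat)) set)"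
  have lin: "lp_bounded_linear p L" if "L \<in> \<F>" for L
    using that T_bounded_linear
    by (auto simp: \<F>_def intro!: lp_bounded_linear_sum
        lp_bounded_linear_compose[OF lp_bounded_linear_cscale] lp_bounded_linear_funpow)
  have step: "\<exists>x\<in>lp p. \<exists>L\<in>\<F>. lp_norm p (x - z) < e \<and> lp_norm p (L x - y) < e"
    if z: "z \<in> c00" and y: "y \<in> c00" and e: "0 < e" for z y e
  proof -
    have zy_lp: "z \<in> lp p" "y \<in> lp p"
      using z y by (auto intro: c00_in_lp)
    define F where "F = {n. z n \<noteq> 0} \<union> {n. y n \<noteq> 0}"
    define R where "R = (\<Sum>n\<in>F. \<bar>n\<bar>)"
    have F: "finite F"
      using z y by (simp add: F_def c00_def)
    have "\<bar>n\<bar> \<le> R" if "n \<in> F" for n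
      unfolding R_def using F that by (intro member_le_sum) auto
    then have R: "\<And>n. z n \<noteq> 0 \<Longrightarrow> \<bar>n\<bar> \<le> R" "\<And>n. y n \<noteq> 0 \<Longrightarrow> \<bar>n\<bar> \<le> R"
      by (auto simp: F_def)
    have "0 \<le> R"
      by (simp add: R_def sum_nonneg)
    define q where "q = nat (2 * R + 1)"
    \<comment> \<open>\<open>Q\<close> is a multiple of \<open>N\<close>, so the translations by \<open>Q * 2 ^ i\<close> are powers of \<open>T ^^ N\<close>.\<close>
    define Q where "Q = int N * int q"
    have Q: "2 * R < Q"
    proof -
      have "2 * R < int q"
        using \<open>0 \<le> R\<close> by (simp add: q_def)
      also have "\<dots> \<le> Q"
        using N mult_right_mono[of 1 "int N" "int q"] by (simp add: Q_def)
      finally show ?thesis .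
    qed
    define \<delta> where "\<delta> = (\<lambda>K::nat. real K powr (1 / p - 1 / 2))"
    define B where "B = lp_norm p z + lp_norm p y + 1"
    have B: "0 < B" "lp_norm p z + lp_norm p y < B"
      using lp_norm_nonneg[of p z] lp_norm_nonneg[of p y] unfolding B_def by linarith+
    have "\<delta> \<longlonglongrightarrow> 0"
      unfolding \<delta>_def using assms(1)
      by (intro tendsto_neg_powr filterlim_real_sequentially) (simp add: field_simps)
    then have "\<forall>\<^sub>F K in sequentially. \<delta> K < min 1 (e / B)"
      using B e by (intro order_tendstoD) auto
    then have "\<forall>\<^sub>F K in sequentially. \<delta> K < min 1 (e / B) \<and> 1 \<le> K"
      using eventually_ge_at_top by (rule eventually_conj)
    then obtain K where K: "\<delta> K < 1" "\<delta> K < e / B" "1 \<le> K"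
      by (metis (no_types, lifting) eventually_happens min_less_iff_conj sequentially_bot)
    define a where "a = real K powr (- 1 / 2)"
    have a: "0 < a" "a * a * real K = 1" "a * real K powr (1 / p) = \<delta> K"
    proof -
      show "0 < a"
        using K by (simp add: a_def)
      have "a * a = real K powr (- 1)"
        unfolding a_def powr_add[symmetric] by simp
      then show "a * a * real K = 1"
        using K by (simp add: powr_minus field_simps)
      show "a * real K powr (1 / p) = \<delta> K"
        unfolding a_def \<delta>_def powr_add[symmetric] by simp
    qed
    have \<delta>0: "0 \<le> \<delta> K"
      by (simp add: \<delta>_def)
    define h where "h = (\<Sum>j<K. unit_translate (Q * - (2 ^ j)) y)"
    define x where "x = z + cscale (of_real a) h"
    have h_lp: "h \<in> lp p"
      unfolding h_def by (intro sum_in_lp c00_in_lp translate_in_c00 y)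
    have ah_lp: "cscale (of_real a) h \<in> lp p"
      by (rule cscale_in_lp[OF h_lp])
    have x: "x \<in> lp p"
      unfolding x_def by (intro add_in_lp zy_lp ah_lp)
    have "lp_norm p (x - z) = a * lp_norm p h"
      using a(1) by (simp add: x_def lp_norm_cscale h_lp)
    also have "\<dots> \<le> a * (real K powr (1 / p) * lp_norm p y)"
      using lp_norm_sum_disjoint_translates[of "{..<K}" "\<lambda>j. - (2 ^ j)" y R Q] R zy_lp Q a(1)
      unfolding h_def by (intro mult_left_mono) (auto simp: inj_on_def)
    also have "\<dots> = \<delta> K * lp_norm p y"
      by (simp flip: a(3))
    also have "\<dots> \<le> \<delta> K * B"
      using \<delta>0 lp_norm_nonneg[of p z] by (intro mult_left_mono) (simp_all add: B_def)
    also have "\<dots> < e"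
      using K(2) B(1) by (simp add: field_simps)
    finally have near_z: "lp_norm p (x - z) < e" .
    define L where "L = (\<lambda>x. \<Sum>i<K. cscale (of_real a) (((T ^^ N) ^^ (q * 2 ^ i)) x))"
    have "L \<in> \<F>"
      unfolding \<F>_def by (rule image_eqI[of _ _ "(of_real a, K, \<lambda>i. q * 2 ^ i)"]) (auto simp: L_def)
    define u where "u = (\<Sum>i<K. unit_translate (Q * 2 ^ i) z)"
    define P where "P = (SIGMA i:{..<K}. {..<K} - {i})"
    define v where "v = (\<Sum>t\<in>P. unit_translate (Q * (2 ^ fst t - 2 ^ snd t)) y)"
    have u_lp: "u \<in> lp p" and v_lp: "v \<in> lp p"
      unfolding u_def v_def by (intro sum_in_lp c00_in_lp translate_in_c00 y z)+
    \<comment> \<open>The \<open>K\<close> diagonal terms of the double sum add up to \<open>y\<close>; the off-diagonal ones, collected in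
       \<open>v\<close>, have disjoint supports.\<close>
    have "L x - y = cscale (of_real a) u + cscale (of_real (a * a)) v"
    proof
      fix n
      define g where "g = (\<lambda>i j. y (n + Q * 2 ^ i + Q * - (2 ^ j)))"
      have Lx: "L x n = (\<Sum>i<K. of_real a * x (n + Q * 2 ^ i))"
      proof -
        have "((T ^^ N) ^^ (q * 2 ^ i)) x = unit_translate (Q * 2 ^ i) x" for i
          using funpow_eq_translate[OF x, of "N * (q * 2 ^ i)"]
          by (simp add: funpow_mult Q_def ac_simps)
        then show ?thesis
          by (simp add: L_def sum_fun_apply unit_translate_apply)
      qed
      have x_at: "x k = z k + of_real a * (\<Sum>j<K. y (k + Q * - (2 ^ j)))" for k
        by (simp add: x_def h_def sum_fun_apply unit_translate_apply)
      have "L x n = (\<Sum>i<K. of_real a * z (n + Q * 2 ^ i) + of_real (a * a) * (\<Sum>j<K. g i j))"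
        unfolding Lx g_def by (intro sum.cong refl) (simp add: x_at distrib_left)
      also have "\<dots> = of_real a * u n + of_real (a * a) * (\<Sum>i<K. \<Sum>j<K. g i j)"
        by (simp add: sum.distrib sum_distrib_left u_def sum_fun_apply unit_translate_apply)
      also have "(\<Sum>i<K. \<Sum>j<K. g i j) = (\<Sum>i<K. y n + (\<Sum>j\<in>{..<K} - {i}. g i j))"
        by (intro sum.cong refl) (subst sum.remove, auto simp: g_def)
      also have "\<dots> = of_nat K * y n + (\<Sum>i<K. \<Sum>j\<in>{..<K} - {i}. g i j)"
        by (simp add: sum.distrib)
      also have "(\<Sum>i<K. \<Sum>j\<in>{..<K} - {i}. g i j) = v n"
        unfolding v_def P_def
        by (subst sum.Sigma)
          (auto simp: sum_fun_apply unit_translate_apply g_def algebra_simps case_prod_unfold)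
      also have "of_real a * u n + of_real (a * a) * (of_nat K * y n + v n) =
          of_real a * u n + (of_real (a * a * real K) * y n + of_real (a * a) * v n)"
        by (simp add: algebra_simps)
      finally show "(L x - y) n = (cscale (of_real a) u + cscale (of_real (a * a)) v) n"
        unfolding a(2) by simp
    qed
    then have "lp_norm p (L x - y) \<le>
        lp_norm p (cscale (of_real a) u) + lp_norm p (cscale (of_real (a * a)) v)"
      using lp_norm_triangle[OF cscale_in_lp[OF u_lp] cscale_in_lp[OF v_lp]] by metis
    also have "\<dots> = a * lp_norm p u + a * a * lp_norm p v"
      using a(1) by (simp add: lp_norm_cscale u_lp v_lp norm_mult)
    also have "\<dots> \<le> a * (real K powr (1 / p) * lp_norm p z) +
        a * a * ((real K powr (1 / p)) * (real K powr (1 / p)) * lp_norm p y)"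
    proof (intro add_mono mult_left_mono)
      show "lp_norm p u \<le> real K powr (1 / p) * lp_norm p z"
        using lp_norm_sum_disjoint_translates[of "{..<K}" "\<lambda>i. 2 ^ i" z R Q] R zy_lp Q
        unfolding u_def by (auto simp: inj_on_def)
      have P: "finite P" "card P \<le> K * K"
      proof -
        have "P \<subseteq> {..<K} \<times> {..<K}"
          by (auto simp: P_def)
        then show "finite P" "card P \<le> K * K"
          using card_mono[of "{..<K} \<times> {..<K}" P] finite_subset[of P "{..<K} \<times> {..<K}"] by auto
      qed
      have "inj_on (\<lambda>t. 2 ^ fst t - 2 ^ snd t :: int) P"
        by (auto simp: inj_on_def P_def dest!: pow2_diff_inject)
      then have "lp_norm p v \<le> real (card P) powr (1 / p) * lp_norm p y"
        unfolding v_def using R zy_lp Q P(1)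
        by (intro lp_norm_sum_disjoint_translates) auto
      also have "\<dots> \<le> real (K * K) powr (1 / p) * lp_norm p y"
        using P(2) p_ge_1 by (intro mult_right_mono powr_mono2) (auto simp flip: of_nat_mult)
      finally show "lp_norm p v \<le> real K powr (1 / p) * real K powr (1 / p) * lp_norm p y"
        by (simp add: powr_mult)
    qed (use a(1) in auto)
    also have "\<dots> = \<delta> K * lp_norm p z + \<delta> K * (\<delta> K * lp_norm p y)"
      by (simp add: algebra_simps flip: a(3))
    also have "\<dots> \<le> \<delta> K * lp_norm p z + \<delta> K * (1 * lp_norm p y)"
      using K(1) \<delta>0 by (intro add_left_mono mult_left_mono mult_right_mono) auto
    also have "\<dots> = \<delta> K * (lp_norm p z + lp_norm p y)"
      by (simp add: distrib_left)
    also have "\<dots> \<le> \<delta> K * B"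
      using \<delta>0 B by (intro mult_left_mono) auto
    also have "\<dots> < e"
      using K(2) B(1) by (simp add: field_simps)
    finally have "lp_norm p (L x - y) < e" .
    with near_z x \<open>L \<in> \<F>\<close> show ?thesis
      by blast
  qed
  obtain x where x: "x \<in> lp p" and dense: "lp_dense p {L x |L. L \<in> \<F>}"
    using universal_vector_exists[of \<F>] lin step by blast
  have "lp_dense p (cfun.span {((T ^^ N) ^^ n) x |n. True})"
  proof (rule lp_dense_mono[OF dense])
    show "{L x |L. L \<in> \<F>} \<subseteq> cfun.span {((T ^^ N) ^^ n) x |n. True}"
      by (auto simp: \<F>_def intro!: cfun.span_sum cfun.span_scale[OF cfun.span_base])
  qed (intro span_subset_lp orbit_subset_lp x)
  with x show ?thesis
    by (auto simp: cyclic_def)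
qed

section \<open>Supercyclicity and cyclicity of powers\<close>

context translation_shift
begin

text \<open>
  Rounding an exponent \<open>n\<close> that works at \<open>m + 1\<close> down to an even number gives one for \<open>m\<close>: the two
  indices together move two steps to the left, which costs the factor \<open>M\<^sup>2\<close>.
\<close>

lemma even_small_products:
  assumes small: "\<And>m e. 0 < e \<Longrightarrow> \<exists>n::nat. norm (c (m - int n)) * norm (c (m + int n)) < e"
    and "0 < e"
  shows "\<exists>n::nat. norm (c (m - int (2 * n))) * norm (c (m + int (2 * n))) < e"
proof -
  have M2: "0 < M\<^sup>2" "1 \<le> M\<^sup>2"
    using M_ge_1 by auto
  obtain n where n: "norm (c (m + 1 - int n)) * norm (c (m + 1 + int n)) < e / M\<^sup>2"
    using small[of "e / M\<^sup>2" "m + 1"] assms(2) M2 by auto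
  define k where "k = n div 2"
  have k: "m - int (2 * k) \<le> m + 1 - int n" "m + int (2 * k) \<le> m + 1 + int n"
    "nat ((m + 1 - int n) - (m - int (2 * k))) + nat ((m + 1 + int n) - (m + int (2 * k))) = 2"
    unfolding k_def by (cases "even n"; auto elim!: evenE oddE)+
  have "norm (c (m - int (2 * k))) * norm (c (m + int (2 * k))) \<le>
      (M ^ nat ((m + 1 - int n) - (m - int (2 * k))) * norm (c (m + 1 - int n))) *
      (M ^ nat ((m + 1 + int n) - (m + int (2 * k))) * norm (c (m + 1 + int n)))"
    using M_ge_1 by (intro mult_mono norm_c_le k) auto
  also have "\<dots> = M\<^sup>2 * (norm (c (m + 1 - int n)) * norm (c (m + 1 + int n)))"
  proof -
    have "M ^ nat ((m + 1 - int n) - (m - int (2 * k))) * M ^ nat ((m + 1 + int n) - (m + int (2 * k)))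
        = M\<^sup>2"
      by (simp only: k(3) flip: power_add)
    moreover have "(a * x) * (b * y) = (a * b) * (x * y)" for a b x y :: real
      by (simp only: ac_simps)
    ultimately show ?thesis
      by simp
  qed
  also have "\<dots> < M\<^sup>2 * (e / M\<^sup>2)"
    using n M2 by (intro mult_strict_left_mono)
  also have "\<dots> = e"
    using M2 by simp
  finally show ?thesis
    by blast
qed

lemma supercyclic_iff_cyclic_square:
  assumes "p \<le> 2"
  shows "supercyclic p T \<longleftrightarrow> cyclic p (T ^^ 2)"
proof
  assume "supercyclic p T"
  from even_small_products[OF supercyclic_imp_small_products[OF this]]
  have "supercyclic p (T ^^ 2)"
    by (intro supercyclic_power)
  then show "cyclic p (T ^^ 2)"
    by (rule supercyclic_imp_cyclic)
next
  assume "cyclic p (T ^^ 2)"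
  from cyclic_square_imp_small_products[OF assms this]
  have "supercyclic p (T ^^ 1)"
    by (intro supercyclic_power) simp
  then show "supercyclic p T"
    by simp
qed

end

theorem corollary1p2:
  shows "(\<forall>p w T. 1 \<le> p \<longrightarrow> p \<le> 2 \<longrightarrow> weighted_bilateral_shift p w T \<longrightarrow>
            (supercyclic p T \<longleftrightarrow> cyclic p (T ^^ 2))) \<and>
         (\<forall>p>2. \<exists>w T. weighted_bilateral_shift p w T \<and> \<not> supercyclic p T \<and>
            (\<forall>n\<ge>1. cyclic p (T ^^ n)))"
proof (intro conjI allI impI)
  fix p :: real and w T
  assume "1 \<le> p" "p \<le> 2" "weighted_bilateral_shift p w T"
  then obtain c M where "translation_shift p T c M"
    using translation_shift_exists by blast
  then show "supercyclic p T \<longleftrightarrow> cyclic p (T ^^ 2)"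
    using \<open>p \<le> 2\<close> by (rule translation_shift.supercyclic_iff_cyclic_square)
next
  fix p :: real
  assume p: "2 < p"
  define T :: "(int \<Rightarrow> complex) \<Rightarrow> int \<Rightarrow> complex" where "T = (\<lambda>x n. 1 * x (n + 1))"
  have T: "weighted_bilateral_shift p (\<lambda>_. 1) T"
    unfolding T_def using p weighted_bilateral_shift_coords[of p "\<lambda>_. 1"] by simp
  interpret translation_shift p T "\<lambda>_. 1" 1
    using p T
    by unfold_locales (auto simp: weighted_bilateral_shift_def T_def translate_def)
  have "\<not> supercyclic p T"
    using supercyclic_imp_small_products[of 1] by auto
  moreover have "\<forall>n\<ge>1. cyclic p (T ^^ n)"
    using unweighted_shift_power_cyclic[OF p translation_shift_axioms] by blast
  ultimately show "\<exists>w T. weighted_bilateral_shift p w T \<and> \<not> supercyclic p T \<and>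
      (\<forall>n\<ge>1. cyclic p (T ^^ n))"
    using T by blast
qed

end
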